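(* Let $(M,\mathcal T)$ be a closed pseudo 3-manifold with edge set $E$. For any generalized hyper-ideal metric $l_0\in\mathbb R^E_{>0}$, there exists a unique solution $l:[0,\infty)\to\mathbb R^E_{>0}$, for all time $t\in[0,\infty)$, of the extended Ricci flow $$\frac{d}{dt}l_e(t)=\widetilde K_e(l(t))\,l_e(t)\quad(e\in E,\ t\ge 0),\qquad l(0)=l_0 .$$
   Context: Closed pseudo 3-manifold. Let $T_1,\dots,T_t$ be finitely many combinatorial tetrahedra with disjoint union $\mathscr T$. A closed pseudo 3-manifold $(M,\mathcal T)$ is the quotient of $\mathscr T$ by a family of affine isomorphisms pairing faces of the tetrahedra, such that each codimension-1 face is identified with another codimension-1 face. Its edge set $E$ is the set of equivalence classes of edges of $T_1,\dots,T_t$ under the gluing; $P_E$ is the projection from the edges of $\mathscr T$ to $E$. $\mathbb R^E_{>0}$ is the set of positive functions on $E$; its elements are called generalized hyper-ideal metrics. Extended dihedral angles. For $l=(l_{12},l_{13},l_{14},l_{23},l_{24},l_{34})\in\mathbb R^6_{\ge0}$, with $l_{ij}=l_{ji}$, $c_{ij}=\cosh l_{ij}$, $s_{ij}=\sinh l_{ij}$ and $\{i,j,k,h\}=\{1,2,3,4\}$, set $$\phi_{ij}(l)=\frac{c_{ik}c_{ih}+c_{jk}c_{jh}+c_{ij}c_{ik}c_{jh}+c_{ij}c_{ih}c_{jk}-s_{ij}^2c_{kh}}{\sqrt{2c_{ij}c_{ik}c_{jk}+c_{ij}^2+c_{ik}^2+c_{jk}^2-1}\,\sqrt{2c_{ij}c_{ih}c_{jh}+c_{ij}^2+c_{ih}^2+c_{jh}^2-1}},$$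 and let the extended dihedral angle at edge $\{i,j\}$ be $\alpha_{ij}(l)=\arccos\big(\max(-1,\min(\phi_{ij}(l),1))\big)$. Generalized Ricci curvature. Given $l\in\mathbb R^E_{>0}$, give each edge $\hat e$ of each tetrahedron $T_j$ the length $\hat l(\hat e)=l(P_E(\hat e))$, and let $\alpha(\hat e)$ be the extended dihedral angle at $\hat e$ in the tetrahedron $T_j$ containing it, computed from the six lengths of $T_j$. Then $\widetilde K_e(l)=2\pi-\sum_{\hat e\in P_E^{-1}(e)}\alpha(\hat e)$ for $e\in E$. *)

theory Defs
  imports "HOL-Analysis.Analysis"
begin

text \<open>
  The tetrahedra are indexed by a finite type \<open>'j\<close>, and the vertices of each of them are labelled
  by the four-element type \<open>4\<close>. A codimension-1 face is given by a pair \<open>(j, v)\<close>, where \<open>v\<close> is the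
  vertex of tetrahedron \<open>j\<close> opposite to the face. The edge of tetrahedron \<open>j\<close> with end points
  \<open>a \<noteq> b\<close> is the pair \<open>(j, {a, b})\<close>. Since the index \<open>j\<close> is carried along, different tetrahedra
  are disjoint even when their realisations in space overlap.

  The face \<open>f\<close> is glued to the face \<open>partner T f\<close> along the map \<open>glue T f\<close>, of which only the
  values on the face \<open>f\<close> matter.
\<close>

record 'j face_gluing =
  vert :: "'j \<Rightarrow> 4 \<Rightarrow> real^3"
  partner :: "'j \<times> 4 \<Rightarrow> 'j \<times> 4"
  glue :: "'j \<times> 4 \<Rightarrow> real^3 \<Rightarrow> real^3"

definition subsimplex :: "'j face_gluing \<Rightarrow> 'j \<times> 4 set \<Rightarrow> (real^3) set"
  where "subsimplex T = (\<lambda>(j, s). convex hull (vert T j ` s))"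

definition face :: "'j face_gluing \<Rightarrow> 'j \<times> 4 \<Rightarrow> (real^3) set"
  where "face T = (\<lambda>(j, v). subsimplex T (j, - {v}))"

definition affine_isomorphism ::
  "(real^3) set \<Rightarrow> (real^3) set \<Rightarrow> (real^3 \<Rightarrow> real^3) \<Rightarrow> bool"
  where "affine_isomorphism A B g \<longleftrightarrow>
    bij_betw g A B \<and> (\<exists>L b. linear L \<and> (\<forall>x\<in>A. g x = L x + b))"

definition closed_pseudo_3_manifold :: "'j::finite face_gluing \<Rightarrow> bool"
  where "closed_pseudo_3_manifold T \<longleftrightarrow>
    (\<forall>j. inj (vert T j) \<and> \<not> affine_dependent (range (vert T j))) \<and>
    (\<forall>f. partner T f \<noteq> f \<and> partner T (partner T f) = f) \<and>
    (\<forall>f. affine_isomorphism (face T f) (face T (partner T f)) (glue T f)) \<and>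
    (\<forall>f. \<forall>x\<in>face T f. glue T (partner T f) (glue T f x) = x)"

definition tet_edges :: "('j \<times> 4 set) set"
  where "tet_edges = {(j, s). card s = 2}"

definition glued_edges :: "'j face_gluing \<Rightarrow> (('j \<times> 4 set) \<times> ('j \<times> 4 set)) set"
  where "glued_edges T = {(x, y). x \<in> tet_edges \<and> y \<in> tet_edges \<and>
    (\<exists>f. fst f = fst x \<and> snd f \<notin> snd x \<and>
         fst (partner T f) = fst y \<and> snd (partner T f) \<notin> snd y \<and>
         glue T f ` subsimplex T x = subsimplex T y)}"

definition edge_rel :: "'j face_gluing \<Rightarrow> (('j \<times> 4 set) \<times> ('j \<times> 4 set)) set"
  where "edge_rel T = Restr ((glued_edges T \<union> (glued_edges T)\<inverse>)\<^sup>*) tet_edges"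

lemma equiv_edge_rel: "equiv tet_edges (edge_rel T)"
proof -
  have "sym ((glued_edges T \<union> (glued_edges T)\<inverse>)\<^sup>*)"
    by (intro sym_rtrancl sym_Un_converse)
  then show ?thesis
    unfolding edge_rel_def
    by (intro equivI refl_onI symI transI) (auto dest: symD intro: rtrancl_trans)
qed

definition edge_set :: "'j face_gluing \<Rightarrow> ('j \<times> 4 set) set set"
  where "edge_set T = tet_edges // edge_rel T"

definition edge_proj :: "'j face_gluing \<Rightarrow> 'j \<times> 4 set \<Rightarrow> ('j \<times> 4 set) set"
  where "edge_proj T x = edge_rel T `` {x}"

definition hyperideal_metrics :: "'j face_gluing \<Rightarrow> (('j \<times> 4 set) set \<Rightarrow> real) set"
  where "hyperideal_metrics T = edge_set T \<rightarrow>\<^sub>E {0<..}"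

text \<open>
  The six lengths of a single tetrahedron are a function on two-element sets of labels, so that
  \<open>l\<^sub>i\<^sub>j = l\<^sub>j\<^sub>i\<close> is built in.
\<close>

definition dihedral_cos :: "(4 set \<Rightarrow> real) \<Rightarrow> 4 \<Rightarrow> 4 \<Rightarrow> 4 \<Rightarrow> 4 \<Rightarrow> real"
  where "dihedral_cos l i j k h =
    (let c = (\<lambda>a b. cosh (l {a, b})); s = (\<lambda>a b. sinh (l {a, b})) in
      (c i k * c i h + c j k * c j h + c i j * c i k * c j h + c i j * c i h * c j k
         - (s i j)\<^sup>2 * c k h) /
      (sqrt (2 * c i j * c i k * c j k + (c i j)\<^sup>2 + (c i k)\<^sup>2 + (c j k)\<^sup>2 - 1) *
       sqrt (2 * c i j * c i h * c j h + (c i j)\<^sup>2 + (c i h)\<^sup>2 + (c j h)\<^sup>2 - 1)))"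

text \<open>
  The value does not depend on how the labels are named, see the lemma \<open>ext_dihedral_angle_eq\<close>.
\<close>

definition ext_dihedral_angle :: "(4 set \<Rightarrow> real) \<Rightarrow> 4 set \<Rightarrow> real"
  where "ext_dihedral_angle l s = (THE \<alpha>. \<exists>i j k h. s = {i, j} \<and> {i, j, k, h} = UNIV \<and>
    \<alpha> = arccos (max (-1) (min (dihedral_cos l i j k h) 1)))"

lemma dihedral_cos_swap12: "dihedral_cos l j i k h = dihedral_cos l i j k h"
  by (simp add: dihedral_cos_def Let_def insert_commute algebra_simps)

lemma dihedral_cos_swap34: "dihedral_cos l i j h k = dihedral_cos l i j k h"
  by (simp add: dihedral_cos_def Let_def insert_commute algebra_simps)

lemma ext_dihedral_angle_eq:
  assumes "{i, j, k, h} = (UNIV :: 4 set)"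
  shows "ext_dihedral_angle l {i, j} = arccos (max (-1) (min (dihedral_cos l i j k h) 1))"
proof -
  have dist: "distinct [a, b, c, d]" if "{a, b, c, d} = (UNIV :: 4 set)" for a b c d
  proof (rule card_distinct)
    show "card (set [a, b, c, d]) = length [a, b, c, d]"
      using that by simp
  qed
  have "dihedral_cos l i' j' k' h' = dihedral_cos l i j k h"
    if "{i, j} = {i', j'}" "{i', j', k', h'} = UNIV" for i' j' k' h'
  proof -
    have "{k', h'} = - {i', j'}" "{k, h} = - {i, j}"
      using dist[OF that(2)] dist[OF assms] that(2) assms by auto
    then have "{k, h} = {k', h'}"
      using that(1) by simp
    with that(1) show ?thesis
      by (auto simp: doubleton_eq_iff dihedral_cos_swap12 dihedral_cos_swap34)
  qed
  then show ?thesis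
    unfolding ext_dihedral_angle_def
    by (intro the_equality) (use assms in \<open>blast, metis\<close>)
qed

definition ext_curvature ::
  "'j::finite face_gluing \<Rightarrow> (('j \<times> 4 set) set \<Rightarrow> real) \<Rightarrow> ('j \<times> 4 set) set \<Rightarrow> real"
  where "ext_curvature T l e =
    2 * pi - (\<Sum>(j, s) \<in> {x \<in> tet_edges. edge_proj T x = e}.
                ext_dihedral_angle (\<lambda>s'. l (edge_proj T (j, s'))) s)"

end

theory Submission
  imports Defs "HOL-Complex_Analysis.Great_Picard"
begin

text \<open>
  In the coordinates \<open>u = ln l\<close> the flow is the ODE \<open>u' = K (exp u)\<close> with a bounded continuous right-hand
  side, so Peano's theorem gives solutions on every interval \<open>[0, b]\<close>. The right-hand side is not locally
  Lipschitz where a tetrahedron degenerates, and uniqueness rests on a one-sided Lipschitz bound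
  \<open>(K l - K l') \<bullet> (l - l') \<le> C |l - l'|\<^sup>2\<close> on bounded sets: it makes \<open>\<Sum> (l - l')\<^sup>2 / l\<close> grow at most
  exponentially along two solutions.

  For the bound, consider one tetrahedron along a segment of length vectors, and let \<open>D\<close> be minus the Gram
  determinant. Where \<open>D \<le> 0\<close>, all angles are \<open>0\<close> or \<open>pi\<close>. Where \<open>D > 0\<close>, the Jacobian of the angles is
  \<open>1 / sqrt D\<close> times a quadratic form that is, up to an error of order \<open>D\<close>, a nonnegative multiple of a
  square, hence it is bounded below by a multiple of \<open>- sqrt D\<close>.
\<close>

subsection \<open>Cofactor identities\<close>

text \<open>The angles behave like \<open>sqrt D\<close> at a degeneration, so the entries of their
  Jacobian blow up like \<open>1 / sqrt D\<close> and no two-sided Lipschitz bound can be expected.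
  But the singular part has rank one and a good sign: it is a multiple of the square of the
  derivative of \<open>D\<close> along the segment. What remains is of order
  \<open>D / sqrt D = sqrt D\<close>, hence bounded. So exactly one half of the Lipschitz condition
  survives, and it is the half that forward uniqueness needs, because the curvature contains the
  angles with a minus sign.

  How a segment meets the set \<open>D = 0\<close> is never analysed. Outside \<open>D > 0\<close>
  the pairing of the angles with the fixed direction takes only finitely many values, and this is
  enough for a mean value argument.

  The bound pairs \<open>K l - K l'\<close> with differences of lengths, whereas the flow is driven
  by \<open>K\<close> in the coordinates \<open>ln l\<close>. The weight \<open>1 / l\<close>
  reconciles the two: in the derivative of \<open>(l - l')\<^sup>2 / l\<close> it cancels the factor
  \<open>l\<close> of the flow and leaves the unweighted pairing, up to terms controlled by the
  boundedness of \<open>K\<close>.\<close>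

text \<open>
  The arguments \<open>a, b, c, d, e, f\<close> stand for \<open>cosh l\<close> at the edges \<open>12, 13, 14, 23, 24, 34\<close>, in this order.
  The matrix with diagonal entries \<open>1\<close> and off-diagonal entries \<open>-cosh l\<^sub>i\<^sub>j\<close> is the Gram matrix of the
  four spacelike vectors dual to the truncation planes. Up to sign, \<open>gram\<close> is its determinant, \<open>tri\<close>
  a diagonal entry and \<open>num\<close> an off-diagonal entry of its adjugate, so the cosine of a dihedral angle is
  a normalised cofactor. The identities below are instances of Jacobi's identity for the minors of the
  adjugate.
\<close>

definition tri :: "real \<Rightarrow> real \<Rightarrow> real \<Rightarrow> real"
  where "tri x y z = 2 * x * y * z + x\<^sup>2 + y\<^sup>2 + z\<^sup>2 - 1"

definition num :: "real \<Rightarrow> real \<Rightarrow> real \<Rightarrow> real \<Rightarrow> real \<Rightarrow> real \<Rightarrow> real"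
  where "num a b c d e f = b * c + d * e + a * b * e + a * c * d - (a\<^sup>2 - 1) * f"

definition gram :: "real \<Rightarrow> real \<Rightarrow> real \<Rightarrow> real \<Rightarrow> real \<Rightarrow> real \<Rightarrow> real"
  where "gram a b c d e f = a\<^sup>2 + b\<^sup>2 + c\<^sup>2 + d\<^sup>2 + e\<^sup>2 + f\<^sup>2 - 1
    + 2 * (a * b * d + a * c * e + b * c * f + d * e * f)
    - (a\<^sup>2 * f\<^sup>2 + b\<^sup>2 * e\<^sup>2 + c\<^sup>2 * d\<^sup>2)
    + 2 * (a * f * b * e + a * f * c * d + b * e * c * d)"

lemma tri_mult_tri:
  "tri a b d * tri a c e - (num a b c d e f)\<^sup>2 = (a\<^sup>2 - 1) * gram a b c d e f"
  unfolding tri_def num_def gram_def by algebra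

text \<open>Here \<open>c + a * e\<close> and \<open>2 * (a * d + b)\<close> are the partial
  derivatives of \<open>num\<close> and \<open>tri a b d\<close> in \<open>b\<close>, so the
  left-hand side is the numerator of the derivative of \<open>num / sqrt tri\<close>. The effect of
  edge 13 on the angle at 12 is thus governed by the cofactor of edge 23, the third edge of their
  common face.\<close>

lemma num_deriv_adjacent:
  "(c + a * e) * tri a b d - num a b c d e f * (a * d + b) = (a\<^sup>2 - 1) * num d a e b f c"
  unfolding tri_def num_def by algebra

text \<open>The counterpart for the variable \<open>a\<close> of the edge itself, with reversed
  sign. The first term pairs the cofactors of the opposite edges 23 and 14; the second is
  nonnegative when \<open>gram\<close> is and all entries are at least 1, and is later
  discarded.\<close>

lemma num_deriv_self:
  "num a b c d e f * ((b * d + a) * tri a c e + (c * e + a) * tri a b d)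
     - (b * e + c * d - 2 * a * f) * tri a b d * tri a c e
   = (a\<^sup>2 - 1) * num d a e b f c * num c a b e f d + gram a b c d e f * (b + d * a) * (e + c * a)"
  unfolding tri_def num_def gram_def by algebra

lemma num_swap:
  "num a d e b c f = num a b c d e f" "num a c b e d f = num a b c d e f" "num a e d c b f = num a b c d e f"
  by (simp_all add: num_def algebra_simps)

lemma tri_commute:
  "tri a d b = tri a b d" "tri b a d = tri a b d" "tri d b a = tri a b d"
  "tri b d a = tri a b d" "tri d a b = tri a b d"
  by (simp_all add: tri_def algebra_simps)

text \<open>
  The derivative of the dihedral angle at edge \<open>12\<close>, multiplied by \<open>sqrt ((a\<^sup>2 - 1) * gram a b c d e f)\<close>;
  the primed arguments are the derivatives of \<open>a, \<dots>, f\<close>.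
\<close>

definition rate :: "real \<Rightarrow> real \<Rightarrow> real \<Rightarrow> real \<Rightarrow> real \<Rightarrow> real \<Rightarrow>
    real \<Rightarrow> real \<Rightarrow> real \<Rightarrow> real \<Rightarrow> real \<Rightarrow> real \<Rightarrow> real"
  where "rate a b c d e f a' b' c' d' e' f' =
    num a b c d e f * (((a * d + b) * b' + (a * b + d) * d' + (b * d + a) * a') / tri a b d
                     + ((a * e + c) * c' + (a * c + e) * e' + (c * e + a) * a') / tri a c e)
    - ((c + a * e) * b' + (b + a * d) * c' + (e + a * c) * d' + (d + a * b) * e'
       + (b * e + c * d - 2 * a * f) * a' - (a\<^sup>2 - 1) * f')"

lemma rate_eq:
  assumes "tri a b d \<noteq> 0" "tri a c e \<noteq> 0"
  shows "rate a b c d e f a' b' c' d' e' f' = (a\<^sup>2 - 1) * (f'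
     - num d a e b f c * b' / tri a b d - num b a c d f e * d' / tri a b d
     - num e a d c f b * c' / tri a c e - num c a b e f d * e' / tri a c e)
     + ((a\<^sup>2 - 1) * num d a e b f c * num c a b e f d + gram a b c d e f * (b + d * a) * (e + c * a))
       / (tri a b d * tri a c e) * a'"
proof -
  define N S U V where "N = num a b c d e f" and "S = a\<^sup>2 - 1" and "U = tri a b d" and "V = tri a c e"
  \<comment> \<open>Facts 1 to 4 are one identity under the relabellings that preserve edge 12, one
    for each of its four adjacent edges.\<close>
  have 1: "S * num d a e b f c = (c + a * e) * U - N * (a * d + b)"
    using num_deriv_adjacent[of c a e b d f] by (simp add: N_def S_def U_def)
  have 2: "S * num b a c d f e = (e + a * c) * U - N * (a * b + d)"
    using num_deriv_adjacent[of e a c d b f] by (simp add: N_def S_def U_def num_swap tri_commute)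
  have 3: "S * num e a d c f b = (b + a * d) * V - N * (a * e + c)"
    using num_deriv_adjacent[of b a d c e f] by (simp add: N_def S_def V_def num_swap tri_commute)
  have 4: "S * num c a b e f d = (d + a * b) * V - N * (a * c + e)"
    using num_deriv_adjacent[of d a b e c f] by (simp add: N_def S_def V_def num_swap tri_commute)
  have 5: "S * num d a e b f c * num c a b e f d + gram a b c d e f * (b + d * a) * (e + c * a)
     = N * ((b * d + a) * V + (c * e + a) * U) - (b * e + c * d - 2 * a * f) * U * V"
    using num_deriv_self[of a b c d e f] by (simp add: N_def S_def U_def V_def)
  have nz: "U \<noteq> 0" "V \<noteq> 0"
    using assms by (simp_all add: U_def V_def)
  have "rate a b c d e f a' b' c' d' e' f' = S * f'
    - ((c + a * e) * U - N * (a * d + b)) * b' / U - ((e + a * c) * U - N * (a * b + d)) * d' / U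
    - ((b + a * d) * V - N * (a * e + c)) * c' / V - ((d + a * b) * V - N * (a * c + e)) * e' / V
    + (N * ((b * d + a) * V + (c * e + a) * U) - (b * e + c * d - 2 * a * f) * U * V) / (U * V) * a'"
    unfolding rate_def N_def[symmetric] S_def[symmetric] U_def[symmetric] V_def[symmetric]
    using nz by (simp add: field_simps)
  then show ?thesis
    unfolding 1[symmetric] 2[symmetric] 3[symmetric] 4[symmetric] 5[symmetric]
    by (simp add: S_def U_def V_def algebra_simps)
qed

text \<open>In the application, \<open>r1\<close> to \<open>r4\<close> are the square roots of
  \<open>tri\<close> of the face opposite each vertex. The scaling of the \<open>z\<close> variables
  removes all face factors: the mixed coefficients become 1 for the opposite edge and minus a cosine
  for an adjacent one, which is symmetric in the two edges involved. The inequality comes from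
  dropping the \<open>gram\<close> term of \<open>num_deriv_self\<close>.\<close>

lemma rate_mult_ge:
  assumes "a > 1" "b \<ge> 1" "c \<ge> 1" "d \<ge> 1" "e \<ge> 1" "gram a b c d e f \<ge> 0"
    and r: "r1 > 0" "r2 > 0" "r3 > 0" "r4 > 0" "r3\<^sup>2 = tri a c e" "r4\<^sup>2 = tri a b d"
    and p: "num d a e b f c = p23 * (r1 * r4)" "num b a c d f e = p13 * (r2 * r4)"
      "num e a d c f b = p24 * (r1 * r3)" "num c a b e f d = p14 * (r2 * r3)"
    and z: "z12 = r1 * r2 * a'" "z13 = r1 * r3 * b'" "z14 = r1 * r4 * c'"
      "z23 = r2 * r3 * d'" "z24 = r2 * r4 * e'" "z34 = r3 * r4 * f'"
  shows "r1 * r2 * r3 * r4 * (a' * rate a b c d e f a' b' c' d' e' f' / (a\<^sup>2 - 1)) \<ge>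
    z12 * z34 - z12 * z13 * p23 - z12 * z23 * p13 - z12 * z14 * p24 - z12 * z24 * p14
      + z12\<^sup>2 * (p23 * p14)"
proof -
  define S where "S = a\<^sup>2 - 1"
  define G where "G = gram a b c d e f * (b + d * a) * (e + c * a)"
  have S: "S > 0"
    using assms by (simp add: S_def)
  have "G \<ge> 0"
    unfolding G_def using assms by (intro mult_nonneg_nonneg add_nonneg_nonneg) auto
  then have pos: "r1 * r2 * r3 * r4 * (a'\<^sup>2 * G / (r4\<^sup>2 * r3\<^sup>2 * S)) \<ge> 0"
    using r(1-4) S by (intro mult_nonneg_nonneg divide_nonneg_nonneg) auto
  have nz: "tri a b d \<noteq> 0" "tri a c e \<noteq> 0"
    using r by (auto simp flip: r(5,6))
  have "r1 * r2 * r3 * r4 * (a' * rate a b c d e f a' b' c' d' e' f' / S)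
    = z12 * z34 - z12 * z13 * p23 - z12 * z23 * p13 - z12 * z14 * p24 - z12 * z24 * p14
      + z12\<^sup>2 * (p23 * p14) + r1 * r2 * r3 * r4 * (a'\<^sup>2 * G / (r4\<^sup>2 * r3\<^sup>2 * S))"
    unfolding rate_eq[OF nz] p z S_def[symmetric] G_def[symmetric] r(5,6)[symmetric]
    using r(1-4) S by (simp add: field_simps power2_eq_square)
  with pos show ?thesis
    by (simp add: S_def)
qed

subsection \<open>The Jacobian of the dihedral angles\<close>

lemma mult_ge_neg_squares:
  fixes c m x y :: real
  assumes "\<bar>c\<bar> \<le> 2 * m"
  shows "2 * c * x * y \<ge> - 2 * (m * x\<^sup>2) - 2 * (m * y\<^sup>2)"
proof -
  have "\<bar>2 * c * x * y\<bar> = \<bar>c\<bar> * (2 * \<bar>x\<bar> * \<bar>y\<bar>)"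
    by (simp add: abs_mult)
  also have "\<dots> \<le> 2 * m * (x\<^sup>2 + y\<^sup>2)"
    using assms sum_squares_bound[of "\<bar>x\<bar>" "\<bar>y\<bar>"] by (intro mult_mono) auto
  finally show ?thesis
    by (simp add: algebra_simps)
qed

text \<open>
  In normalised coordinates \<open>z\<^sub>i\<^sub>j\<close>, the quadratic form of the Jacobian of the angles without a nonnegative
  diagonal part; \<open>p\<^sub>i\<^sub>j\<close> is the cosine of the angle at \<open>ij\<close>. As the Gram determinant tends to \<open>0\<close>, the
  cosines tend to \<open>1\<close> or \<open>-1\<close>, and the form tends to the square of \<open>p\<^sub>3\<^sub>4 z\<^sub>1\<^sub>2 + p\<^sub>2\<^sub>4 z\<^sub>1\<^sub>3 + \<dots>\<close>.
\<close>

definition angle_form where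
  "angle_form p12 p13 p14 p23 p24 p34 z12 z13 z14 z23 z24 z34 =
    z12\<^sup>2 * (p14 * p23) + z13\<^sup>2 * (p14 * p23) + z14\<^sup>2 * (p13 * p24) +
    z23\<^sup>2 * (p13 * p24) + z24\<^sup>2 * (p14 * p23) + z34\<^sup>2 * (p14 * p23)
    + 2 * (z12 * z34 + z13 * z24 + z14 * z23)
    - 2 * (z12 * z13 * p23 + z12 * z14 * p24 + z13 * z14 * p34
         + z12 * z23 * p13 + z12 * z24 * p14 + z23 * z24 * p34
         + z13 * z23 * p12 + z13 * z34 * p14 + z23 * z34 * p24
         + z14 * z24 * p12 + z14 * z34 * p13 + z24 * z34 * (p23 :: real))"

text \<open>Each variable occurs in one square and five mixed products, and each occurrence costs at
  most its square; hence 6. This serves the case where the Gram determinant is not small.\<close>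

lemma angle_form_ge_crude:
  assumes "\<bar>p12\<bar> \<le> 1" "\<bar>p13\<bar> \<le> 1" "\<bar>p14\<bar> \<le> 1" "\<bar>p23\<bar> \<le> 1" "\<bar>p24\<bar> \<le> 1" "\<bar>p34\<bar> \<le> 1"
  shows "angle_form p12 p13 p14 p23 p24 p34 z12 z13 z14 z23 z24 z34
    \<ge> - 6 * (z12\<^sup>2 + z13\<^sup>2 + z14\<^sup>2 + z23\<^sup>2 + z24\<^sup>2 + z34\<^sup>2)"
proof -
  have diag: "x\<^sup>2 * (p * q) \<ge> - x\<^sup>2" if "\<bar>p\<bar> \<le> 1" "\<bar>q\<bar> \<le> 1" for x p q :: real
  proof -
    have "\<bar>p * q\<bar> \<le> 1"
      using that by (simp add: abs_mult mult_le_one)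
    then have "x\<^sup>2 * (p * q) \<ge> x\<^sup>2 * (-1)"
      by (intro mult_left_mono) auto
    then show ?thesis
      by simp
  qed
  have off: "2 * (x * y * p) \<le> x\<^sup>2 + y\<^sup>2" "2 * (x * y) \<ge> - (x\<^sup>2 + y\<^sup>2)" if "\<bar>p\<bar> \<le> 1" for x y p :: real
    using mult_ge_neg_squares[of "- p" "1/2" x y] mult_ge_neg_squares[of 1 "1/2" x y] that
    by (simp_all add: algebra_simps)
  show ?thesis
    unfolding angle_form_def
    using diag[OF assms(3,4), of z12] diag[OF assms(3,4), of z13] diag[OF assms(2,5), of z14]
      diag[OF assms(2,5), of z23] diag[OF assms(3,4), of z24] diag[OF assms(3,4), of z34]
      off(2)[OF assms(1), of z12 z34] off(2)[OF assms(1), of z13 z24] off(2)[OF assms(1), of z14 z23]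
      off(1)[OF assms(4), of z12 z13] off(1)[OF assms(5), of z12 z14] off(1)[OF assms(6), of z13 z14]
      off(1)[OF assms(2), of z12 z23] off(1)[OF assms(3), of z12 z24] off(1)[OF assms(6), of z23 z24]
      off(1)[OF assms(1), of z13 z23] off(1)[OF assms(3), of z13 z34] off(1)[OF assms(5), of z23 z34]
      off(1)[OF assms(1), of z14 z24] off(1)[OF assms(2), of z14 z34] off(1)[OF assms(4), of z24 z34]
    by (simp only: mult.assoc[symmetric] distrib_left)
qed

text \<open>Subtracting the limiting square leaves coefficients of order \<open>\<kappa>\<close>:
  each variable loses 2 in its own square and 2 in each of five products, hence 12. The diagonal of
  \<open>angle_form\<close> does not treat the three pairs of opposite edges alike; all three
  products of opposite cosines lie within \<open>2 * \<kappa>\<close> of 1, so this asymmetry is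
  absorbed.\<close>

lemma angle_form_ge:
  assumes le1: "\<bar>p12\<bar> \<le> 1" "\<bar>p13\<bar> \<le> 1" "\<bar>p14\<bar> \<le> 1" "\<bar>p23\<bar> \<le> 1" "\<bar>p24\<bar> \<le> 1" "\<bar>p34\<bar> \<le> 1"
    and sq: "1 - p12\<^sup>2 \<le> \<kappa>" "1 - p13\<^sup>2 \<le> \<kappa>" "1 - p14\<^sup>2 \<le> \<kappa>" "1 - p23\<^sup>2 \<le> \<kappa>" "1 - p24\<^sup>2 \<le> \<kappa>" "1 - p34\<^sup>2 \<le> \<kappa>"
    and opp: "p12 * p34 > 0" "p13 * p24 > 0" "p14 * p23 > 0"
    and v1: "\<bar>p12 + p13 * p14\<bar> \<le> \<kappa>" "\<bar>p13 + p12 * p14\<bar> \<le> \<kappa>" "\<bar>p14 + p12 * p13\<bar> \<le> \<kappa>"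
    and v2: "\<bar>p12 + p23 * p24\<bar> \<le> \<kappa>" "\<bar>p23 + p12 * p24\<bar> \<le> \<kappa>" "\<bar>p24 + p12 * p23\<bar> \<le> \<kappa>"
    and v3: "\<bar>p13 + p23 * p34\<bar> \<le> \<kappa>" "\<bar>p23 + p13 * p34\<bar> \<le> \<kappa>" "\<bar>p34 + p13 * p23\<bar> \<le> \<kappa>"
    and v4: "\<bar>p14 + p24 * p34\<bar> \<le> \<kappa>" "\<bar>p24 + p14 * p34\<bar> \<le> \<kappa>" "\<bar>p34 + p14 * p24\<bar> \<le> \<kappa>"
  shows "angle_form p12 p13 p14 p23 p24 p34 z12 z13 z14 z23 z24 z34
    \<ge> - 12 * \<kappa> * (z12\<^sup>2 + z13\<^sup>2 + z14\<^sup>2 + z23\<^sup>2 + z24\<^sup>2 + z34\<^sup>2)"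
proof -
  \<comment> \<open>The equal sign of \<open>p\<close> and \<open>q\<close> matters: it makes them
    close to each other, not merely both close to 1 or -1.\<close>
  have prod: "1 - p * q \<le> 2 * \<kappa> \<and> p * q \<le> 1 \<and> \<bar>p - q\<bar> \<le> \<kappa>"
    if "p * q > 0" "\<bar>p\<bar> \<le> 1" "\<bar>q\<bar> \<le> 1" "1 - p\<^sup>2 \<le> \<kappa>" "1 - q\<^sup>2 \<le> \<kappa>" for p q :: real
  proof -
    have sq_le: "x\<^sup>2 \<le> \<bar>x\<bar>" if "\<bar>x\<bar> \<le> 1" for x :: real
      using that mult_left_le_one_le[of "\<bar>x\<bar>" "\<bar>x\<bar>"] by (simp add: power2_eq_square abs_mult_self_eq)
    have low: "\<bar>p\<bar> \<ge> 1 - \<kappa>" "\<bar>q\<bar> \<ge> 1 - \<kappa>"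
      using that sq_le[of p] sq_le[of q] by auto
    have le: "p * q \<le> 1"
      using that(2,3) by (metis abs_ge_self abs_ge_zero abs_mult mult_le_one order.trans)
    have pq: "p * q = \<bar>p\<bar> * \<bar>q\<bar>"
      using that(1) by (metis abs_mult abs_of_pos)
    have "(1 - \<bar>p\<bar>) * (1 - \<bar>q\<bar>) \<ge> 0"
      using that(2,3) by (intro mult_nonneg_nonneg) auto
    then have "1 - p * q \<le> 2 * \<kappa>"
      using low unfolding pq by (simp add: algebra_simps)
    moreover have "\<bar>p - q\<bar> \<le> \<kappa>"
      using that(1-3) low by (auto simp: zero_less_mult_iff)
    ultimately show ?thesis
      using le by simp
  qed
  note P = prod[OF opp(1) le1(1,6) sq(1,6)] prod[OF opp(2) le1(2,5) sq(2,5)] prod[OF opp(3) le1(3,4) sq(3,4)]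
  have sq1: "p\<^sup>2 \<le> 1" if "\<bar>p\<bar> \<le> 1" for p :: real
    using that by (simp add: abs_square_le_1)
  have diag: "x\<^sup>2 * d \<ge> - 2 * (\<kappa> * x\<^sup>2)" if "d \<ge> - 2 * \<kappa>" for x d :: real
    using mult_right_mono[OF that, of "x\<^sup>2"] by (simp add: algebra_simps)
  have d: "p14 * p23 - p34\<^sup>2 \<ge> - 2 * \<kappa>" "p14 * p23 - p24\<^sup>2 \<ge> - 2 * \<kappa>" "p13 * p24 - p23\<^sup>2 \<ge> - 2 * \<kappa>"
    "p13 * p24 - p14\<^sup>2 \<ge> - 2 * \<kappa>" "p14 * p23 - p13\<^sup>2 \<ge> - 2 * \<kappa>" "p14 * p23 - p12\<^sup>2 \<ge> - 2 * \<kappa>"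
    using P le1[THEN sq1] by auto
  have o: "\<bar>1 - p12 * p34\<bar> \<le> 2 * \<kappa>" "\<bar>1 - p13 * p24\<bar> \<le> 2 * \<kappa>" "\<bar>1 - p14 * p23\<bar> \<le> 2 * \<kappa>"
    using P by auto
  have adj: "\<bar>- q - y * x\<bar> \<le> 2 * \<kappa>" if "\<bar>p - q\<bar> \<le> \<kappa> \<or> \<bar>q - p\<bar> \<le> \<kappa>" "\<bar>p + x * y\<bar> \<le> \<kappa>" for p q x y :: real
    using that by (auto simp: mult.commute[of y] abs_le_iff)
  have pq: "\<bar>p12 - p34\<bar> \<le> \<kappa>" "\<bar>p13 - p24\<bar> \<le> \<kappa>" "\<bar>p14 - p23\<bar> \<le> \<kappa>"
    using P by blast+
  note a =
    adj[OF disjI1[OF pq(3)] v4(1)]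
    adj[OF disjI1[OF pq(2)] v3(1)]
    adj[OF disjI1[OF pq(1)] v2(1)]
    adj[OF disjI2[OF pq(2)] v4(2)]
    adj[OF disjI2[OF pq(3)] v3(2)]
    adj[OF disjI1[OF pq(1)] v1(1)]
    adj[OF disjI2[OF pq(1)] v4(3)]
    adj[OF disjI2[OF pq(3)] v2(2)]
    adj[OF disjI1[OF pq(2)] v1(2)]
    adj[OF disjI2[OF pq(1)] v3(3)]
    adj[OF disjI2[OF pq(2)] v2(3)]
    adj[OF disjI1[OF pq(3)] v1(3)]
  \<comment> \<open>For the values inserted in \<open>rates_ge\<close>, this is half the derivative
    of \<open>gram\<close> along the path: the partial derivative of \<open>gram\<close> in the
    variable of an edge is twice the \<open>num\<close> of the opposite edge.\<close>
  define t where "t = p34 * z12 + p24 * z13 + p23 * z14 + p14 * z23 + p13 * z24 + p12 * z34"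
  have "angle_form p12 p13 p14 p23 p24 p34 z12 z13 z14 z23 z24 z34 = t\<^sup>2
    + z12\<^sup>2 * (p14 * p23 - p34\<^sup>2) + z13\<^sup>2 * (p14 * p23 - p24\<^sup>2) + z14\<^sup>2 * (p13 * p24 - p23\<^sup>2)
    + z23\<^sup>2 * (p13 * p24 - p14\<^sup>2) + z24\<^sup>2 * (p14 * p23 - p13\<^sup>2) + z34\<^sup>2 * (p14 * p23 - p12\<^sup>2)
    + 2 * (1 - p12 * p34) * z12 * z34 + 2 * (1 - p13 * p24) * z13 * z24 + 2 * (1 - p14 * p23) * z14 * z23
    + 2 * (- p23 - p34 * p24) * z12 * z13 + 2 * (- p24 - p34 * p23) * z12 * z14
    + 2 * (- p34 - p24 * p23) * z13 * z14 + 2 * (- p13 - p34 * p14) * z12 * z23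
    + 2 * (- p14 - p34 * p13) * z12 * z24 + 2 * (- p34 - p14 * p13) * z23 * z24
    + 2 * (- p12 - p24 * p14) * z13 * z23 + 2 * (- p14 - p24 * p12) * z13 * z34
    + 2 * (- p24 - p14 * p12) * z23 * z34 + 2 * (- p12 - p23 * p13) * z14 * z24
    + 2 * (- p13 - p23 * p12) * z14 * z34 + 2 * (- p23 - p13 * p12) * z24 * z34"
    unfolding angle_form_def t_def by (simp add: algebra_simps power2_eq_square)
  moreover have "- 12 * \<kappa> * (z12\<^sup>2 + z13\<^sup>2 + z14\<^sup>2 + z23\<^sup>2 + z24\<^sup>2 + z34\<^sup>2) =
    - 12 * (\<kappa> * z12\<^sup>2) - 12 * (\<kappa> * z13\<^sup>2) - 12 * (\<kappa> * z14\<^sup>2)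
    - 12 * (\<kappa> * z23\<^sup>2) - 12 * (\<kappa> * z24\<^sup>2) - 12 * (\<kappa> * z34\<^sup>2)"
    by (simp add: algebra_simps)
  ultimately show ?thesis
    using zero_le_power2[of t]
      diag[OF d(1), of z12] diag[OF d(2), of z13] diag[OF d(3), of z14]
      diag[OF d(4), of z23] diag[OF d(5), of z24] diag[OF d(6), of z34]
      mult_ge_neg_squares[OF o(1), of z12 z34] mult_ge_neg_squares[OF o(2), of z13 z24]
      mult_ge_neg_squares[OF o(3), of z14 z23]
      mult_ge_neg_squares[OF a(1), of z12 z13] mult_ge_neg_squares[OF a(2), of z12 z14]
      mult_ge_neg_squares[OF a(3), of z13 z14] mult_ge_neg_squares[OF a(4), of z12 z23]
      mult_ge_neg_squares[OF a(5), of z12 z24] mult_ge_neg_squares[OF a(6), of z23 z24]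
      mult_ge_neg_squares[OF a(7), of z13 z23] mult_ge_neg_squares[OF a(8), of z13 z34]
      mult_ge_neg_squares[OF a(9), of z23 z34] mult_ge_neg_squares[OF a(10), of z14 z24]
      mult_ge_neg_squares[OF a(11), of z14 z34] mult_ge_neg_squares[OF a(12), of z24 z34]
    by linarith
qed

text \<open>The relations \<open>v\<close> force an odd number of negative cosines at each vertex.
  The edge sets of the complete graph on four vertices with all degrees odd are the perfect
  matchings, the stars and the full graph. A star leaves a face without negative edges, which
  \<open>neg\<close> forbids; in the other cases opposite edges agree in sign.\<close>

lemma opposite_cos_same_sign:
  assumes sq: "1 - p12\<^sup>2 \<le> \<kappa>" "1 - p13\<^sup>2 \<le> \<kappa>" "1 - p14\<^sup>2 \<le> \<kappa>" "1 - p23\<^sup>2 \<le> \<kappa>" "1 - p24\<^sup>2 \<le> \<kappa>" "1 - p34\<^sup>2 \<le> \<kappa>"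
    and \<kappa>: "\<kappa> \<le> 1 / 4"
    and v: "\<bar>p12 + p13 * p14\<bar> \<le> \<kappa>" "\<bar>p12 + p23 * p24\<bar> \<le> \<kappa>" "\<bar>p13 + p23 * p34\<bar> \<le> \<kappa>" "\<bar>p14 + p24 * p34\<bar> \<le> \<kappa>"
    and neg: "p23 < 0 \<or> p24 < 0 \<or> p34 < 0" "p13 < 0 \<or> p14 < 0 \<or> p34 < 0"
      "p12 < 0 \<or> p14 < 0 \<or> p24 < 0" "p12 < 0 \<or> p13 < 0 \<or> p23 < (0::real)"
  shows "p12 * p34 > 0 \<and> p13 * p24 > 0 \<and> p14 * p23 > 0"
proof -
  have *: "x * y * z < 0" if "1 - x\<^sup>2 \<le> \<kappa>" "1 - y\<^sup>2 \<le> \<kappa>" "1 - z\<^sup>2 \<le> \<kappa>" "\<bar>x + y * z\<bar> \<le> \<kappa>" for x y z :: real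
  proof -
    have half: "\<bar>t\<bar> > 1/2" if "1 - t\<^sup>2 \<le> \<kappa>" for t :: real
    proof (rule ccontr)
      assume "\<not> ?thesis"
      then have "t\<^sup>2 \<le> (1/2)\<^sup>2"
        using power_mono[of "\<bar>t\<bar>" "1/2" 2] by simp
      with that \<kappa> show False
        by (simp add: power2_eq_square)
    qed
    have "\<bar>x\<bar> > 1/2" "\<bar>y\<bar> > 1/2" "\<bar>z\<bar> > 1/2"
      using that(1-3)[THEN half] by auto
    then have "\<bar>y * z\<bar> > 1/4" "\<bar>x\<bar> > 1/4"
      using mult_strict_mono[of "1/2" "\<bar>y\<bar>" "1/2" "\<bar>z\<bar>"] by (simp_all add: abs_mult)
    then have "x > 0 \<and> y * z < 0 \<or> x < 0 \<and> y * z > 0"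
      using that(4) \<kappa> by linarith
    then have "x * (y * z) < 0"
      by (auto simp: mult_less_0_iff zero_less_mult_iff)
    then show ?thesis
      by (simp add: mult.assoc)
  qed
  have odd: "((x < 0) = ((y < 0) = (z < 0))) \<and> x \<noteq> 0 \<and> y \<noteq> 0 \<and> z \<noteq> 0" if "x * y * z < 0" for x y z :: real
    using that by (auto simp: mult_less_0_iff zero_less_mult_iff)
  have "x * y > 0" if "(x < 0) = (y < 0)" "x \<noteq> 0" "y \<noteq> 0" for x y :: real
    using that by (auto simp: zero_less_mult_iff)
  moreover note odd[OF *[OF sq(1-3) v(1)]] odd[OF *[OF sq(1,4,5) v(2)]]
    odd[OF *[OF sq(2,4,6) v(3)]] odd[OF *[OF sq(3,5,6) v(4)]]
  ultimately show ?thesis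
    using neg by blast
qed

section \<open>Quantitative estimates for the normalised cofactors of a tetrahedron\<close>

lemma cos_bounds:
  fixes r r' :: real
  assumes "r \<ge> 2" "r' \<ge> 2" "r\<^sup>2 * r'\<^sup>2 - N\<^sup>2 = S * D" "0 \<le> S" "S \<le> m" "0 \<le> D"
  shows "\<bar>N / (r * r')\<bar> \<le> 1" "1 - (N / (r * r'))\<^sup>2 \<le> m * D / 8"
proof -
  have rr: "(r * r')\<^sup>2 \<ge> 16"
    using mult_mono[of 2 r 2 r'] power_mono[of 4 "r * r'" 2] assms(1,2) by simp
  have eq: "1 - (N / (r * r'))\<^sup>2 = S * D / (r * r')\<^sup>2"
    using assms(1,2) unfolding assms(3)[symmetric] by (simp add: power_divide power_mult_distrib diff_divide_distrib)
  have "0 \<le> S * D" "S * D \<le> m * D"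
    using assms by (auto intro: mult_right_mono)
  then have "0 \<le> S * D / (r * r')\<^sup>2" "S * D / (r * r')\<^sup>2 \<le> m * D / 8"
    using rr frac_le[of "m * D" "S * D" 8 "(r * r')\<^sup>2"] by simp_all
  then show "\<bar>N / (r * r')\<bar> \<le> 1" "1 - (N / (r * r'))\<^sup>2 \<le> m * D / 8"
    unfolding eq[symmetric] using abs_square_le_1[of "N / (r * r')"] by linarith+
qed

text \<open>The fourth assumption is Jacobi's identity for a 2 by 2 minor of the adjugate, where
  \<open>x\<close>, \<open>y\<close>, \<open>z\<close> are the cofactors of three edges meeting at a
  vertex. The bounded quantity is the numerator in the angular law of cosines for the triangle cut
  off at that vertex.\<close>

lemma vertex_bound:
  fixes r r' r'' :: real
  assumes "r \<ge> 2" "r' \<ge> 2" "r'' \<ge> 2" "r\<^sup>2 * x + y * z = D * g" "0 \<le> g" "g \<le> 2 * m" "0 \<le> D"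
  shows "\<bar>x / (r' * r'') + y / (r * r'') * (z / (r * r'))\<bar> \<le> m * D / 8"
proof -
  have eq: "x / (r' * r'') + y / (r * r'') * (z / (r * r')) = D * g / ((r * r') * (r * r''))"
    using assms(1-3) unfolding assms(4)[symmetric] by (simp add: field_simps power2_eq_square)
  have "r * r' \<ge> 4" "r * r'' \<ge> 4"
    using mult_mono[of 2 r 2 r'] mult_mono[of 2 r 2 r''] assms(1-3) by auto
  then have rr: "(r * r') * (r * r'') \<ge> 16"
    using mult_mono[of 4 "r * r'" 4 "r * r''"] by simp
  have "D * g \<le> D * (2 * m)"
    using assms by (intro mult_left_mono) auto
  moreover have "0 \<le> D * g"
    using assms by simp
  ultimately have "0 \<le> D * g / ((r * r') * (r * r''))"
    "D * g / ((r * r') * (r * r'')) \<le> D * (2 * m) / 16"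
    using rr frac_le[of "D * (2 * m)" "D * g" 16 "(r * r') * (r * r'')"] by simp_all
  then show ?thesis
    unfolding eq by (simp add: mult_ac)
qed

lemma tri_bounds:
  assumes "x \<ge> 1" "y \<ge> 1" "z \<ge> 1" "x \<le> M" "y \<le> M" "z \<le> M"
  shows "4 \<le> tri x y z" "tri x y z \<le> 5 * M ^ 3"
proof -
  have "1 \<le> x * y * z" "x * y * z \<le> M * M * M"
    using assms mult_mono[of 1 "x * y" 1 z] mult_mono[of 1 x 1 y]
    by (auto intro!: mult_mono)
  moreover have "1 \<le> v\<^sup>2" "v\<^sup>2 \<le> M ^ 3" if "1 \<le> v" "v \<le> M" for v
  proof -
    show "1 \<le> v\<^sup>2"
      using that by simp
    have "v\<^sup>2 \<le> M\<^sup>2"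
      using that by (intro power_mono) auto
    also have "M\<^sup>2 \<le> M ^ 3"
      using that by (intro power_increasing) auto
    finally show "v\<^sup>2 \<le> M ^ 3" .
  qed
  note this[OF assms(1,4)] this[OF assms(2,5)] this[OF assms(3,6)]
  ultimately show "4 \<le> tri x y z" "tri x y z \<le> 5 * M ^ 3"
    by (simp_all add: tri_def power3_eq_cube)
qed

text \<open>If the primed variables are derivatives of \<open>cosh l\<close>, then
  \<open>a' = sinh l * l'\<close> and \<open>a\<^sup>2 - 1\<close> is the square of
  \<open>sinh l\<close>. Hence \<open>?q\<close> is \<open>sqrt (gram a b c d e f)\<close> times the
  sum over all edges of (derivative of the angle) times (derivative of the length).\<close>

lemma rates_ge:
  assumes gt: "1 < a" "1 < b" "1 < c" "1 < d" "1 < e" "1 < f"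
    and le: "a \<le> M" "b \<le> M" "c \<le> M" "d \<le> M" "e \<le> M" "f \<le> M"
    and G: "0 < gram a b c d e f"
  shows "- 300 * M ^ 8 * gram a b c d e f * (a'\<^sup>2 + b'\<^sup>2 + c'\<^sup>2 + d'\<^sup>2 + e'\<^sup>2 + f'\<^sup>2) \<le>
    a' * rate a b c d e f a' b' c' d' e' f' / (a\<^sup>2 - 1)
    + b' * rate b a c d f e b' a' c' d' f' e' / (b\<^sup>2 - 1)
    + c' * rate c a b e f d c' a' b' e' f' d' / (c\<^sup>2 - 1)
    + d' * rate d a e b f c d' a' e' b' f' c' / (d\<^sup>2 - 1)
    + e' * rate e a d c f b e' a' d' c' f' b' / (e\<^sup>2 - 1)
    + f' * rate f b d c e a f' b' d' c' e' a' / (f\<^sup>2 - 1)"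
    (is "_ \<le> ?q")
proof -
  define D where "D = gram a b c d e f"
  define r1 where "r1 = sqrt (tri d e f)"
  define r2 where "r2 = sqrt (tri b c f)"
  define r3 where "r3 = sqrt (tri a c e)"
  define r4 where "r4 = sqrt (tri a b d)"
  define p12 where "p12 = num a b c d e f / (r3 * r4)"
  define p13 where "p13 = num b a c d f e / (r2 * r4)"
  define p14 where "p14 = num c a b e f d / (r2 * r3)"
  define p23 where "p23 = num d a e b f c / (r1 * r4)"
  define p24 where "p24 = num e a d c f b / (r1 * r3)"
  define p34 where "p34 = num f b d c e a / (r1 * r2)"
  define z12 where "z12 = r1 * r2 * a'"
  define z13 where "z13 = r1 * r3 * b'"
  define z14 where "z14 = r1 * r4 * c'"
  define z23 where "z23 = r2 * r3 * d'"
  define z24 where "z24 = r2 * r4 * e'"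
  define z34 where "z34 = r3 * r4 * f'"
  define m where "m = M\<^sup>2"
  have D: "D > 0"
    using G by (simp add: D_def)
  have M: "M \<ge> 1" "m \<ge> 1"
    using gt(1) le(1) by (simp_all add: m_def)
  have ge1: "a \<ge> 1" "b \<ge> 1" "c \<ge> 1" "d \<ge> 1" "e \<ge> 1" "f \<ge> 1"
    using gt by auto
  have tri: "4 \<le> tri d e f" "tri d e f \<le> 5 * M ^ 3" "4 \<le> tri b c f" "tri b c f \<le> 5 * M ^ 3"
    "4 \<le> tri a c e" "tri a c e \<le> 5 * M ^ 3" "4 \<le> tri a b d" "tri a b d \<le> 5 * M ^ 3"
    using ge1 le by (simp_all add: tri_bounds)
  have r2: "r1\<^sup>2 = tri d e f" "r2\<^sup>2 = tri b c f" "r3\<^sup>2 = tri a c e" "r4\<^sup>2 = tri a b d"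
    using tri by (simp_all add: r1_def r2_def r3_def r4_def)
  have r: "r1 \<ge> 2" "r2 \<ge> 2" "r3 \<ge> 2" "r4 \<ge> 2"
    using tri by (simp_all add: r1_def r2_def r3_def r4_def real_le_rsqrt)
  then have rpos: "r1 > 0" "r2 > 0" "r3 > 0" "r4 > 0"
    by auto
  have S: "0 \<le> x\<^sup>2 - 1" "x\<^sup>2 - 1 \<le> m" if "1 < x" "x \<le> M" for x
    using power_mono[of x M 2] one_le_power[of x 2] that unfolding m_def by linarith+
  have c12: "r3\<^sup>2 * r4\<^sup>2 - (num a b c d e f)\<^sup>2 = (a\<^sup>2 - 1) * D"
    unfolding r2 D_def tri_def num_def gram_def by algebra
  have c13: "r2\<^sup>2 * r4\<^sup>2 - (num b a c d f e)\<^sup>2 = (b\<^sup>2 - 1) * D"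
    unfolding r2 D_def tri_def num_def gram_def by algebra
  have c14: "r2\<^sup>2 * r3\<^sup>2 - (num c a b e f d)\<^sup>2 = (c\<^sup>2 - 1) * D"
    unfolding r2 D_def tri_def num_def gram_def by algebra
  have c23: "r1\<^sup>2 * r4\<^sup>2 - (num d a e b f c)\<^sup>2 = (d\<^sup>2 - 1) * D"
    unfolding r2 D_def tri_def num_def gram_def by algebra
  have c24: "r1\<^sup>2 * r3\<^sup>2 - (num e a d c f b)\<^sup>2 = (e\<^sup>2 - 1) * D"
    unfolding r2 D_def tri_def num_def gram_def by algebra
  have c34: "r1\<^sup>2 * r2\<^sup>2 - (num f b d c e a)\<^sup>2 = (f\<^sup>2 - 1) * D"
    unfolding r2 D_def tri_def num_def gram_def by algebra
  note b12 = cos_bounds[OF r(3) r(4) c12 S[OF gt(1) le(1)] less_imp_le[OF D], folded p12_def]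
  note b13 = cos_bounds[OF r(2) r(4) c13 S[OF gt(2) le(2)] less_imp_le[OF D], folded p13_def]
  note b14 = cos_bounds[OF r(2) r(3) c14 S[OF gt(3) le(3)] less_imp_le[OF D], folded p14_def]
  note b23 = cos_bounds[OF r(1) r(4) c23 S[OF gt(4) le(4)] less_imp_le[OF D], folded p23_def]
  note b24 = cos_bounds[OF r(1) r(3) c24 S[OF gt(5) le(5)] less_imp_le[OF D], folded p24_def]
  note b34 = cos_bounds[OF r(1) r(2) c34 S[OF gt(6) le(6)] less_imp_le[OF D], folded p34_def]
  have gb: "0 \<le> x + y * z" "x + y * z \<le> 2 * m" if "1 \<le> x" "1 \<le> y" "1 \<le> z" "x \<le> M" "y \<le> M" "z \<le> M" for x y z
  proof -
    have "y * z \<le> m" "x \<le> m"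
      using that mult_mono[of y M z M] mult_mono[of x M 1 M] by (simp_all add: m_def power2_eq_square)
    then show "0 \<le> x + y * z" "x + y * z \<le> 2 * m"
      using that by auto
  qed
  have "r2\<^sup>2 * num a b c d e f + num b a c d f e * num c a b e f d = D * (f + b * c)"
    unfolding r2 D_def tri_def num_def gram_def by algebra
  from vertex_bound[OF r(2) r(3) r(4) this gb less_imp_le[OF D]] ge1 le
  have w12: "\<bar>p12 + p13 * p14\<bar> \<le> m * D / 8"
    by (simp add: p12_def p13_def p14_def mult.commute)
  have "r3\<^sup>2 * num b a c d f e + num a b c d e f * num c a b e f d = D * (e + a * c)"
    unfolding r2 D_def tri_def num_def gram_def by algebra
  from vertex_bound[OF r(3) r(2) r(4) this gb less_imp_le[OF D]] ge1 le
  have w13: "\<bar>p13 + p12 * p14\<bar> \<le> m * D / 8"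
    by (simp add: p13_def p12_def p14_def mult.commute)
  have "r4\<^sup>2 * num c a b e f d + num a b c d e f * num b a c d f e = D * (d + a * b)"
    unfolding r2 D_def tri_def num_def gram_def by algebra
  from vertex_bound[OF r(4) r(2) r(3) this gb less_imp_le[OF D]] ge1 le
  have w14: "\<bar>p14 + p12 * p13\<bar> \<le> m * D / 8"
    by (simp add: p14_def p12_def p13_def mult.commute)
  have "r1\<^sup>2 * num a b c d e f + num d a e b f c * num e a d c f b = D * (f + d * e)"
    unfolding r2 D_def tri_def num_def gram_def by algebra
  from vertex_bound[OF r(1) r(3) r(4) this gb less_imp_le[OF D]] ge1 le
  have w21: "\<bar>p12 + p23 * p24\<bar> \<le> m * D / 8"
    by (simp add: p12_def p23_def p24_def mult.commute)
  have "r3\<^sup>2 * num d a e b f c + num a b c d e f * num e a d c f b = D * (c + a * e)"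
    unfolding r2 D_def tri_def num_def gram_def by algebra
  from vertex_bound[OF r(3) r(1) r(4) this gb less_imp_le[OF D]] ge1 le
  have w23: "\<bar>p23 + p12 * p24\<bar> \<le> m * D / 8"
    by (simp add: p23_def p12_def p24_def mult.commute)
  have "r4\<^sup>2 * num e a d c f b + num a b c d e f * num d a e b f c = D * (b + a * d)"
    unfolding r2 D_def tri_def num_def gram_def by algebra
  from vertex_bound[OF r(4) r(1) r(3) this gb less_imp_le[OF D]] ge1 le
  have w24: "\<bar>p24 + p12 * p23\<bar> \<le> m * D / 8"
    by (simp add: p24_def p12_def p23_def mult.commute)
  have "r1\<^sup>2 * num b a c d f e + num d a e b f c * num f b d c e a = D * (e + d * f)"
    unfolding r2 D_def tri_def num_def gram_def by algebra
  from vertex_bound[OF r(1) r(2) r(4) this gb less_imp_le[OF D]] ge1 le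
  have w31: "\<bar>p13 + p23 * p34\<bar> \<le> m * D / 8"
    by (simp add: p13_def p23_def p34_def mult.commute)
  have "r2\<^sup>2 * num d a e b f c + num b a c d f e * num f b d c e a = D * (c + b * f)"
    unfolding r2 D_def tri_def num_def gram_def by algebra
  from vertex_bound[OF r(2) r(1) r(4) this gb less_imp_le[OF D]] ge1 le
  have w32: "\<bar>p23 + p13 * p34\<bar> \<le> m * D / 8"
    by (simp add: p23_def p13_def p34_def mult.commute)
  have "r4\<^sup>2 * num f b d c e a + num b a c d f e * num d a e b f c = D * (a + b * d)"
    unfolding r2 D_def tri_def num_def gram_def by algebra
  from vertex_bound[OF r(4) r(1) r(2) this gb less_imp_le[OF D]] ge1 le
  have w34: "\<bar>p34 + p13 * p23\<bar> \<le> m * D / 8"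
    by (simp add: p34_def p13_def p23_def mult.commute)
  have "r1\<^sup>2 * num c a b e f d + num e a d c f b * num f b d c e a = D * (d + e * f)"
    unfolding r2 D_def tri_def num_def gram_def by algebra
  from vertex_bound[OF r(1) r(2) r(3) this gb less_imp_le[OF D]] ge1 le
  have w41: "\<bar>p14 + p24 * p34\<bar> \<le> m * D / 8"
    by (simp add: p14_def p24_def p34_def mult.commute)
  have "r2\<^sup>2 * num e a d c f b + num c a b e f d * num f b d c e a = D * (b + c * f)"
    unfolding r2 D_def tri_def num_def gram_def by algebra
  from vertex_bound[OF r(2) r(1) r(3) this gb less_imp_le[OF D]] ge1 le
  have w42: "\<bar>p24 + p14 * p34\<bar> \<le> m * D / 8"
    by (simp add: p24_def p14_def p34_def mult.commute)
  have "r3\<^sup>2 * num f b d c e a + num c a b e f d * num e a d c f b = D * (a + c * e)"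
    unfolding r2 D_def tri_def num_def gram_def by algebra
  from vertex_bound[OF r(3) r(1) r(2) this gb less_imp_le[OF D]] ge1 le
  have w43: "\<bar>p34 + p14 * p24\<bar> \<le> m * D / 8"
    by (simp add: p34_def p14_def p24_def mult.commute)
  have neg: "x < 0 \<or> y < 0 \<or> z < 0" if "r * r + u * X + v * Y + w * Z = D" "D < 4" "r \<ge> 2"
    "1 \<le> u" "1 \<le> v" "1 \<le> w" "x = X / (s * s')" "y = Y / (t * t')" "z = Z / (q * q')"
    "s \<ge> 2" "s' \<ge> 2" "t \<ge> 2" "t' \<ge> 2" "q \<ge> 2" "q' \<ge> 2"
    for x y z r u v w X Y Z s s' t t' q q' :: real
  proof (rule ccontr)
    assume "\<not> ?thesis"
    moreover have "0 \<le> V" if "\<not> V / (o1 * o2) < 0" "2 \<le> o1" "2 \<le> o2" for V o1 o2 :: real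
    proof (rule ccontr)
      assume "\<not> 0 \<le> V"
      then have "V / (o1 * o2) < 0"
        using that by (intro divide_neg_pos mult_pos_pos) auto
      with that show False
        by simp
    qed
    ultimately have "0 \<le> X" "0 \<le> Y" "0 \<le> Z"
      using that(7-) by blast+
    then have "0 \<le> u * X" "0 \<le> v * Y" "0 \<le> w * Z"
      using that(4-6) by auto
    moreover have "r * r \<ge> 2 * 2"
      using that(3) by (intro mult_mono) auto
    ultimately show False
      using that(1,2) by linarith
  qed
  have form: "angle_form p12 p13 p14 p23 p24 p34 z12 z13 z14 z23 z24 z34
    \<ge> - 12 * m * D * (z12\<^sup>2 + z13\<^sup>2 + z14\<^sup>2 + z23\<^sup>2 + z24\<^sup>2 + z34\<^sup>2)"
  \<comment> \<open>Above this threshold \<open>12 * m * D\<close> exceeds 6, so the crude bound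
    suffices; below it the cosines are close enough to 1 or -1 for their signs to be
    determined.\<close>
  proof (cases "m * D \<le> 1 / 2")
    case True
    have "D \<le> m * D"
      using M D by simp
    then have D4: "D < 4"
      using True by simp
    have "r1 * r1 + a * num f b d c e a + b * num e a d c f b + c * num d a e b f c = D"
      unfolding power2_eq_square[symmetric] r2 D_def tri_def num_def gram_def by algebra
    note n1 = neg[OF this D4 r(1) ge1(1) ge1(2) ge1(3) p34_def p24_def p23_def r(1) r(2) r(1) r(3) r(1) r(4)]
    have "r2 * r2 + a * num f b d c e a + d * num c a b e f d + e * num b a c d f e = D"
      unfolding power2_eq_square[symmetric] r2 D_def tri_def num_def gram_def by algebra
    note n2 = neg[OF this D4 r(2) ge1(1) ge1(4) ge1(5) p34_def p14_def p13_def r(1) r(2) r(2) r(3) r(2) r(4)]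
    have "r3 * r3 + b * num e a d c f b + d * num c a b e f d + f * num a b c d e f = D"
      unfolding power2_eq_square[symmetric] r2 D_def tri_def num_def gram_def by algebra
    note n3 = neg[OF this D4 r(3) ge1(2) ge1(4) ge1(6) p24_def p14_def p12_def r(1) r(3) r(2) r(3) r(3) r(4)]
    have "r4 * r4 + c * num d a e b f c + e * num b a c d f e + f * num a b c d e f = D"
      unfolding power2_eq_square[symmetric] r2 D_def tri_def num_def gram_def by algebra
    note n4 = neg[OF this D4 r(4) ge1(3) ge1(5) ge1(6) p23_def p13_def p12_def r(1) r(4) r(2) r(4) r(3) r(4)]
    have \<kappa>: "m * D / 8 \<le> 1 / 4"
      using True by linarith
    have opp: "p12 * p34 > 0 \<and> p13 * p24 > 0 \<and> p14 * p23 > 0"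
      by (rule opposite_cos_same_sign[OF b12(2) b13(2) b14(2) b23(2) b24(2) b34(2) \<kappa> w12 w21 w31 w41])
        (use n1 n2 n3 n4 in blast)+
    have "angle_form p12 p13 p14 p23 p24 p34 z12 z13 z14 z23 z24 z34
      \<ge> - 12 * (m * D / 8) * (z12\<^sup>2 + z13\<^sup>2 + z14\<^sup>2 + z23\<^sup>2 + z24\<^sup>2 + z34\<^sup>2)"
      using opp by (intro angle_form_ge[OF b12(1) b13(1) b14(1) b23(1) b24(1) b34(1)
        b12(2) b13(2) b14(2) b23(2) b24(2) b34(2) _ _ _ w12 w13 w14 w21 w23 w24 w31 w32 w34 w41 w42 w43]) auto
    moreover have "- 12 * m * D * (z12\<^sup>2 + z13\<^sup>2 + z14\<^sup>2 + z23\<^sup>2 + z24\<^sup>2 + z34\<^sup>2) \<le>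
      - 12 * (m * D / 8) * (z12\<^sup>2 + z13\<^sup>2 + z14\<^sup>2 + z23\<^sup>2 + z24\<^sup>2 + z34\<^sup>2)"
      using M D by (intro mult_right_mono) auto
    ultimately show ?thesis
      by linarith
  next
    case False
    then have "- 12 * m * D * (z12\<^sup>2 + z13\<^sup>2 + z14\<^sup>2 + z23\<^sup>2 + z24\<^sup>2 + z34\<^sup>2) \<le>
      - 6 * (z12\<^sup>2 + z13\<^sup>2 + z14\<^sup>2 + z23\<^sup>2 + z24\<^sup>2 + z34\<^sup>2)"
      by (intro mult_right_mono) (linarith, simp)
    with angle_form_ge_crude[OF b12(1) b13(1) b14(1) b23(1) b24(1) b34(1)] show ?thesis
      by (rule order.trans[rotated])
  qed
  have N: "num a b c d e f = p12 * (r3 * r4)" "num b a c d f e = p13 * (r2 * r4)"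
    "num c a b e f d = p14 * (r2 * r3)" "num d a e b f c = p23 * (r1 * r4)"
    "num e a d c f b = p24 * (r1 * r3)" "num f b d c e a = p34 * (r1 * r2)"
    using rpos by (simp_all add: p12_def p13_def p14_def p23_def p24_def p34_def)
  have G': "gram a b c d e f = D" "gram b a c d f e = D" "gram c a b e f d = D" "gram d a e b f c = D"
    "gram e a d c f b = D" "gram f b d c e a = D"
    by (simp_all add: D_def gram_def algebra_simps)
  have q12: "r1 * r2 * r3 * r4 * (a' * rate a b c d e f a' b' c' d' e' f' / (a\<^sup>2 - 1)) \<ge>
    z12 * z34 - z12 * z13 * p23 - z12 * z23 * p13
    - z12 * z14 * p24 - z12 * z24 * p14 + z12\<^sup>2 * (p23 * p14)"
    by (rule rate_mult_ge)
      (use gt ge1 D rpos in \<open>simp_all add: r2 N[symmetric] G'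
        num_swap tri_commute z12_def z13_def z14_def z23_def z24_def z34_def mult_ac\<close>)
  have q13: "r1 * r3 * r2 * r4 * (b' * rate b a c d f e b' a' c' d' f' e' / (b\<^sup>2 - 1)) \<ge>
    z13 * z24 - z13 * z12 * p23 - z13 * z23 * p12
    - z13 * z14 * p34 - z13 * z34 * p14 + z13\<^sup>2 * (p23 * p14)"
    by (rule rate_mult_ge)
      (use gt ge1 D rpos in \<open>simp_all add: r2 N[symmetric] G'
        num_swap tri_commute z12_def z13_def z14_def z23_def z24_def z34_def mult_ac\<close>)
  have q14: "r1 * r4 * r2 * r3 * (c' * rate c a b e f d c' a' b' e' f' d' / (c\<^sup>2 - 1)) \<ge>
    z14 * z23 - z14 * z12 * p24 - z14 * z24 * p12
    - z14 * z13 * p34 - z14 * z34 * p13 + z14\<^sup>2 * (p24 * p13)"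
    by (rule rate_mult_ge)
      (use gt ge1 D rpos in \<open>simp_all add: r2 N[symmetric] G'
        num_swap tri_commute z12_def z13_def z14_def z23_def z24_def z34_def mult_ac\<close>)
  have q23: "r2 * r3 * r1 * r4 * (d' * rate d a e b f c d' a' e' b' f' c' / (d\<^sup>2 - 1)) \<ge>
    z23 * z14 - z23 * z12 * p13 - z23 * z13 * p12
    - z23 * z24 * p34 - z23 * z34 * p24 + z23\<^sup>2 * (p13 * p24)"
    by (rule rate_mult_ge)
      (use gt ge1 D rpos in \<open>simp_all add: r2 N[symmetric] G'
        num_swap tri_commute z12_def z13_def z14_def z23_def z24_def z34_def mult_ac\<close>)
  have q24: "r2 * r4 * r1 * r3 * (e' * rate e a d c f b e' a' d' c' f' b' / (e\<^sup>2 - 1)) \<ge>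
    z24 * z13 - z24 * z12 * p14 - z24 * z14 * p12
    - z24 * z23 * p34 - z24 * z34 * p23 + z24\<^sup>2 * (p14 * p23)"
    by (rule rate_mult_ge)
      (use gt ge1 D rpos in \<open>simp_all add: r2 N[symmetric] G'
        num_swap tri_commute z12_def z13_def z14_def z23_def z24_def z34_def mult_ac\<close>)
  have q34: "r3 * r4 * r1 * r2 * (f' * rate f b d c e a f' b' d' c' e' a' / (f\<^sup>2 - 1)) \<ge>
    z34 * z12 - z34 * z13 * p14 - z34 * z14 * p13
    - z34 * z23 * p24 - z34 * z24 * p23 + z34\<^sup>2 * (p14 * p23)"
    by (rule rate_mult_ge)
      (use gt ge1 D rpos in \<open>simp_all add: r2 N[symmetric] G'
        num_swap tri_commute z12_def z13_def z14_def z23_def z24_def z34_def mult_ac\<close>)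
  \<comment> \<open>The six estimates above carry this common factor. Since it is at least 1,
    dividing by it keeps any nonpositive lower bound.\<close>
  define R where "R = r1 * r2 * r3 * r4"
  have R: "R \<ge> 1"
    unfolding R_def using r mult_mono[of 2 r1 2 r2] mult_mono[of 4 "r1 * r2" 2 r3] mult_mono[of 8 "r1 * r2 * r3" 2 r4] by simp
  have "angle_form p12 p13 p14 p23 p24 p34 z12 z13 z14 z23 z24 z34 \<le> R * ?q"
  proof -
    have "R * ?q = r1 * r2 * r3 * r4 * (a' * rate a b c d e f a' b' c' d' e' f' / (a\<^sup>2 - 1))
      + r1 * r3 * r2 * r4 * (b' * rate b a c d f e b' a' c' d' f' e' / (b\<^sup>2 - 1))
      + r1 * r4 * r2 * r3 * (c' * rate c a b e f d c' a' b' e' f' d' / (c\<^sup>2 - 1))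
      + r2 * r3 * r1 * r4 * (d' * rate d a e b f c d' a' e' b' f' c' / (d\<^sup>2 - 1))
      + r2 * r4 * r1 * r3 * (e' * rate e a d c f b e' a' d' c' f' b' / (e\<^sup>2 - 1))
      + r3 * r4 * r1 * r2 * (f' * rate f b d c e a f' b' d' c' e' a' / (f\<^sup>2 - 1))"
      by (simp add: R_def distrib_left mult_ac)
    then show ?thesis
      using q12 q13 q14 q23 q24 q34 unfolding angle_form_def by (simp add: algebra_simps)
  qed
  moreover have "z12\<^sup>2 + z13\<^sup>2 + z14\<^sup>2 + z23\<^sup>2 + z24\<^sup>2 + z34\<^sup>2
    \<le> 25 * M ^ 6 * (a'\<^sup>2 + b'\<^sup>2 + c'\<^sup>2 + d'\<^sup>2 + e'\<^sup>2 + f'\<^sup>2)"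
  proof -
    have "(s * t * y)\<^sup>2 \<le> 25 * M ^ 6 * y\<^sup>2" if "s\<^sup>2 \<le> 5 * M ^ 3" "t\<^sup>2 \<le> 5 * M ^ 3" for s t y
    proof -
      have "s\<^sup>2 * t\<^sup>2 \<le> (5 * M ^ 3) * (5 * M ^ 3)"
        using that M by (intro mult_mono) auto
      then have "s\<^sup>2 * t\<^sup>2 * y\<^sup>2 \<le> (5 * M ^ 3) * (5 * M ^ 3) * y\<^sup>2"
        by (intro mult_right_mono) auto
      then show ?thesis
        by (simp add: power_mult_distrib algebra_simps power_add[symmetric])
    qed
    then have "z12\<^sup>2 \<le> 25 * M ^ 6 * a'\<^sup>2" "z13\<^sup>2 \<le> 25 * M ^ 6 * b'\<^sup>2" "z14\<^sup>2 \<le> 25 * M ^ 6 * c'\<^sup>2"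
      "z23\<^sup>2 \<le> 25 * M ^ 6 * d'\<^sup>2" "z24\<^sup>2 \<le> 25 * M ^ 6 * e'\<^sup>2" "z34\<^sup>2 \<le> 25 * M ^ 6 * f'\<^sup>2"
      using tri by (simp_all add: z12_def z13_def z14_def z23_def z24_def z34_def r2)
    then show ?thesis
      by (simp add: distrib_left)
  qed
  then have "12 * m * D * (z12\<^sup>2 + z13\<^sup>2 + z14\<^sup>2 + z23\<^sup>2 + z24\<^sup>2 + z34\<^sup>2)
    \<le> 12 * m * D * (25 * M ^ 6 * (a'\<^sup>2 + b'\<^sup>2 + c'\<^sup>2 + d'\<^sup>2 + e'\<^sup>2 + f'\<^sup>2))"
    using M D by (intro mult_left_mono) auto
  \<comment> \<open>The constant is 12 from the form times 25 from two factors
    \<open>tri \<le> 5 * M ^ 3\<close>; the exponent 8 is 2 from \<open>m\<close> plus 6 from these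
    factors.\<close>
  moreover have "12 * m * D * (25 * M ^ 6 * (a'\<^sup>2 + b'\<^sup>2 + c'\<^sup>2 + d'\<^sup>2 + e'\<^sup>2 + f'\<^sup>2))
    = 300 * M ^ 8 * D * (a'\<^sup>2 + b'\<^sup>2 + c'\<^sup>2 + d'\<^sup>2 + e'\<^sup>2 + f'\<^sup>2)"
    by (simp add: m_def power_add[of M 2 6, simplified] mult_ac)
  ultimately have lower: "R * ?q \<ge> - (300 * M ^ 8 * D * (a'\<^sup>2 + b'\<^sup>2 + c'\<^sup>2 + d'\<^sup>2 + e'\<^sup>2 + f'\<^sup>2))"
    using form by linarith
  have scale: "- K \<le> q" if "- K \<le> R * q" "0 \<le> K" for K q :: real
  proof (cases "q \<ge> 0")
    case False
    then have "R * q \<le> 1 * q"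
      using R by (intro mult_right_mono_neg) auto
    with that show ?thesis
      by simp
  qed (use that in simp)
  have "0 \<le> 300 * M ^ 8 * D * (a'\<^sup>2 + b'\<^sup>2 + c'\<^sup>2 + d'\<^sup>2 + e'\<^sup>2 + f'\<^sup>2)"
    using M D by (intro mult_nonneg_nonneg add_nonneg_nonneg) auto
  from scale[OF lower this] show ?thesis
    by (simp add: D_def)
qed

subsection \<open>One-sided Lipschitz continuity of the extended dihedral angles\<close>

text \<open>
  The induction removes a value \<open>y\<close> of \<open>F\<close> by cutting the interval at the first and the last time at
  which \<open>g\<close> takes the value \<open>y\<close>; in between, \<open>g\<close> does not decrease in total.
\<close>

lemma ge_of_deriv_ge_except_finite_range:
  fixes g :: "real \<Rightarrow> real"
  assumes "finite F" "a \<le> b" "continuous_on {a..b} g" "C \<ge> 0"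
    and "\<And>t. t \<in> {a<..<b} \<Longrightarrow> g t \<in> F \<or> (\<exists>g'. g' \<ge> - C \<and> (g has_real_derivative g') (at t))"
  shows "g b \<ge> g a - C * (b - a)"
  using assms(1,2,3,5)
proof (induction F arbitrary: a b rule: finite_induct)
  case empty
  show ?case
  proof (cases "a = b")
    case False
    with empty have "a < b"
      by simp
    moreover have deriv: "\<exists>g'. g' \<ge> - C \<and> (g has_real_derivative g') (at t)" if "a < t" "t < b" for t
      using empty.prems(3)[of t] that by simp
    then have "g differentiable (at t)" if "a < t" "t < b" for t
      using that unfolding real_differentiable_def by blast
    ultimately obtain l z where z: "a < z" "z < b" "(g has_real_derivative l) (at z)"
      "g b - g a = (b - a) * l"
      using MVT[of a b g] empty.prems(2) by blast
    with deriv[of z] have "l \<ge> - C"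
      using DERIV_unique by blast
    then have "(b - a) * l \<ge> (b - a) * - C"
      using \<open>a < b\<close> by (intro mult_left_mono) auto
    with z(4) show ?thesis
      by (simp add: algebra_simps)
  qed simp
next
  case (insert y F)
  define S where "S = {t \<in> {a..b}. g t = y}"
  show ?case
  proof (cases "S = {}")
    case True
    show ?thesis
    proof (rule insert.IH)
      show "g t \<in> F \<or> (\<exists>g'. g' \<ge> - C \<and> (g has_real_derivative g') (at t))" if t: "t \<in> {a<..<b}" for t
      proof -
        have "g t \<noteq> y"
          using True t by (auto simp: S_def)
        with insert.prems(3)[OF t] show ?thesis
          by blast
      qed
    qed (use insert.prems in auto)
  next
    case False
    have "closed S"
      unfolding S_def using insert.prems(2) by (intro continuous_closed_preimage_constant) auto
    moreover have "bounded S"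
      unfolding S_def by (rule bounded_subset[of "{a..b}"]) auto
    ultimately have "compact S"
      by (simp add: compact_eq_bounded_closed)
    then obtain t1 t2 where t: "t1 \<in> S" "t2 \<in> S" "\<And>s. s \<in> S \<Longrightarrow> t1 \<le> s \<and> s \<le> t2"
      using compact_attains_inf[of S] compact_attains_sup[of S] False by blast
    have "g t1 \<ge> g a - C * (t1 - a)"
    proof (rule insert.IH)
      show "g s \<in> F \<or> (\<exists>g'. g' \<ge> - C \<and> (g has_real_derivative g') (at s))" if s: "s \<in> {a<..<t1}" for s
      proof -
        have "g s \<noteq> y" "s \<in> {a<..<b}"
          using s t(1) t(3)[of s] by (auto simp: S_def)
        with insert.prems(3)[of s] show ?thesis
          by blast
      qed
    qed (use t(1) continuous_on_subset[OF insert.prems(2), of "{a..t1}"] in \<open>auto simp: S_def\<close>)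
    moreover have "g b \<ge> g t2 - C * (b - t2)"
    proof (rule insert.IH)
      show "g s \<in> F \<or> (\<exists>g'. g' \<ge> - C \<and> (g has_real_derivative g') (at s))" if s: "s \<in> {t2<..<b}" for s
      proof -
        have "g s \<noteq> y" "s \<in> {a<..<b}"
          using s t(2) t(3)[of s] by (auto simp: S_def)
        with insert.prems(3)[of s] show ?thesis
          by blast
      qed
    qed (use t(2) continuous_on_subset[OF insert.prems(2), of "{t2..b}"] in \<open>auto simp: S_def\<close>)
    moreover have "C * t1 \<le> C * t2"
      using t \<open>C \<ge> 0\<close> by (intro mult_left_mono) auto
    moreover have "g t1 = g t2"
      using t by (auto simp: S_def)
    ultimately show ?thesis
      unfolding right_diff_distrib by linarith
  qed
qed

section \<open>The clamped arccosine and the derivative of a dihedral angle\<close>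

lemma DERIV_divide_sqrt:
  fixes N U V :: "real \<Rightarrow> real"
  assumes "(N has_real_derivative N') (at t)" "(U has_real_derivative U') (at t)"
    "(V has_real_derivative V') (at t)" "U t > 0" "V t > 0"
  shows "((\<lambda>t. N t / (sqrt (U t) * sqrt (V t))) has_real_derivative
    (N' - N t * (U' / U t + V' / V t) / 2) / (sqrt (U t) * sqrt (V t))) (at t)"
proof -
  have "sqrt (U t) * (sqrt (U t) * x) = U t * x" "sqrt (V t) * (sqrt (V t) * x) = V t * x" for x
    using assms by (simp_all add: mult.assoc[symmetric])
  with assms show ?thesis
    by (auto intro!: derivative_eq_intros simp: divide_simps) (simp add: algebra_simps)
qed

definition clamp_arccos :: "real \<Rightarrow> real"
  where "clamp_arccos x = arccos (max (-1) (min x 1))"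

lemma continuous_on_clamp_arccos [continuous_intros]:
  "continuous_on S f \<Longrightarrow> continuous_on S (\<lambda>x. clamp_arccos (f x))"
  unfolding clamp_arccos_def by (intro continuous_on_arccos continuous_intros) auto

lemma clamp_arccos_bounds: "0 \<le> clamp_arccos x" "clamp_arccos x \<le> pi"
  unfolding clamp_arccos_def by (auto intro!: arccos_lbound arccos_ubound)

lemma clamp_arccos_boundary:
  assumes "x\<^sup>2 \<ge> 1"
  shows "clamp_arccos x \<in> {0, pi}"
proof -
  have "x \<ge> 1 \<or> x \<le> - 1"
    using assms abs_square_less_1[of x] by linarith
  then show ?thesis
    by (elim disjE) (simp_all add: clamp_arccos_def)
qed

lemma DERIV_clamp_arccos:
  assumes f: "(f has_real_derivative f') (at t)" and "(f t)\<^sup>2 < 1"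
  shows "((\<lambda>t. clamp_arccos (f t)) has_real_derivative - f' / sqrt (1 - (f t)\<^sup>2)) (at t)"
proof -
  have lt: "- 1 < f t" "f t < 1"
    using assms(2) abs_square_less_1[of "f t"] by auto
  have "(f \<longlongrightarrow> f t) (nhds t)"
    using DERIV_isCont[OF f] by (simp add: isCont_def tendsto_at_iff_tendsto_nhds)
  from order_tendstoD(1)[OF this lt(1)] order_tendstoD(2)[OF this lt(2)]
  have ev: "\<forall>\<^sub>F s in nhds t. clamp_arccos (f s) = arccos (f s)"
    by eventually_elim (simp add: clamp_arccos_def)
  have "((\<lambda>t. arccos (f t)) has_real_derivative - f' / sqrt (1 - (f t)\<^sup>2)) (at t)"
    using DERIV_chain2[OF DERIV_arccos[OF lt] f] by (simp add: divide_inverse mult.commute)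
  then show ?thesis
    unfolding DERIV_cong_ev[OF refl ev refl] .
qed

definition angle :: "real \<Rightarrow> real \<Rightarrow> real \<Rightarrow> real \<Rightarrow> real \<Rightarrow> real \<Rightarrow> real"
  where "angle a b c d e f = clamp_arccos (num a b c d e f / (sqrt (tri a b d) * sqrt (tri a c e)))"

lemma cos_square_eq:
  assumes "tri a b d > 0" "tri a c e > 0"
  shows "1 - (num a b c d e f / (sqrt (tri a b d) * sqrt (tri a c e)))\<^sup>2 =
    (a\<^sup>2 - 1) * gram a b c d e f / (tri a b d * tri a c e)"
  using assms unfolding tri_mult_tri[symmetric]
  by (simp add: power_divide power_mult_distrib diff_divide_distrib)

text \<open>In \<open>- \<phi>' / sqrt (1 - \<phi>\<^sup>2)\<close> the \<open>tri\<close> factors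
  cancel, because \<open>cos_square_eq\<close> expresses \<open>1 - \<phi>\<^sup>2\<close> over the
  same denominator. Only \<open>sqrt gram\<close> remains as a source of singularity.\<close>

lemma DERIV_angle:
  assumes "(a has_real_derivative a') (at t)" "(b has_real_derivative b') (at t)"
    "(c has_real_derivative c') (at t)" "(d has_real_derivative d') (at t)"
    "(e has_real_derivative e') (at t)" "(f has_real_derivative f') (at t)"
    and pos: "tri (a t) (b t) (d t) > 0" "tri (a t) (c t) (e t) > 0"
    and "a t > 1" "gram (a t) (b t) (c t) (d t) (e t) (f t) > 0"
  shows "((\<lambda>t. angle (a t) (b t) (c t) (d t) (e t) (f t)) has_real_derivative
    rate (a t) (b t) (c t) (d t) (e t) (f t) a' b' c' d' e' f' /
      (sqrt ((a t)\<^sup>2 - 1) * sqrt (gram (a t) (b t) (c t) (d t) (e t) (f t)))) (at t)"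
proof -
  let ?U = "tri (a t) (b t) (d t)" and ?V = "tri (a t) (c t) (e t)"
  let ?N = "num (a t) (b t) (c t) (d t) (e t) (f t)" and ?D = "gram (a t) (b t) (c t) (d t) (e t) (f t)"
  define X where "X = ((a t * d t + b t) * b' + (a t * b t + d t) * d' + (b t * d t + a t) * a')"
  define Y where "Y = ((a t * e t + c t) * c' + (a t * c t + e t) * e' + (c t * e t + a t) * a')"
  define N' where "N' = (c t + a t * e t) * b' + (b t + a t * d t) * c' + (e t + a t * c t) * d'
    + (d t + a t * b t) * e' + (b t * e t + c t * d t - 2 * a t * f t) * a' - ((a t)\<^sup>2 - 1) * f'"
  let ?R = "rate (a t) (b t) (c t) (d t) (e t) (f t) a' b' c' d' e' f'"
  have "?R = ?N * (X / ?U + Y / ?V) - N'"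
    by (simp only: rate_def X_def Y_def N'_def)
  also have "X / ?U + Y / ?V = (2 * X / ?U + 2 * Y / ?V) / 2"
    by (simp add: add_divide_distrib)
  also have "?N * ((2 * X / ?U + 2 * Y / ?V) / 2) - N' = - (N' - ?N * (2 * X / ?U + 2 * Y / ?V) / 2)"
    by (simp only: times_divide_eq_right minus_diff_eq)
  finally have R: "?R = - (N' - ?N * (2 * X / ?U + 2 * Y / ?V) / 2)" .
  have "((\<lambda>t. tri (a t) (b t) (d t)) has_real_derivative 2 * X) (at t)"
    "((\<lambda>t. tri (a t) (c t) (e t)) has_real_derivative 2 * Y) (at t)"
    "((\<lambda>t. num (a t) (b t) (c t) (d t) (e t) (f t)) has_real_derivative N') (at t)"
    unfolding tri_def num_def X_def Y_def N'_def
    by (rule derivative_eq_intros assms(1-6) refl | simp add: algebra_simps power2_eq_square)+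
  from DERIV_divide_sqrt[OF this(3,1,2) pos]
  have \<phi>: "((\<lambda>t. num (a t) (b t) (c t) (d t) (e t) (f t) /
      (sqrt (tri (a t) (b t) (d t)) * sqrt (tri (a t) (c t) (e t)))) has_real_derivative
    - ?R / (sqrt ?U * sqrt ?V)) (at t)"
    unfolding R minus_minus .
  have eq: "1 - (?N / (sqrt ?U * sqrt ?V))\<^sup>2 = ((a t)\<^sup>2 - 1) * ?D / (?U * ?V)"
    using cos_square_eq[OF pos] .
  have "((a t)\<^sup>2 - 1) * ?D / (?U * ?V) > 0"
    using assms by (intro divide_pos_pos mult_pos_pos) auto
  then have lt: "(?N / (sqrt ?U * sqrt ?V))\<^sup>2 < 1"
    unfolding eq[symmetric] by simp
  have sqrt_eq: "sqrt (((a t)\<^sup>2 - 1) * ?D / (?U * ?V)) = sqrt ((a t)\<^sup>2 - 1) * sqrt ?D / (sqrt ?U * sqrt ?V)"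
    by (simp only: real_sqrt_mult real_sqrt_divide)
  have cancel: "- (- r / s) / (x / s) = r / x" if "s \<noteq> 0" for r s x :: real
    using that by simp
  have nz: "sqrt ?U * sqrt ?V \<noteq> 0"
    using pos by simp
  from DERIV_clamp_arccos[OF \<phi> lt] show ?thesis
    unfolding eq sqrt_eq cancel[OF nz] angle_def .
qed

text \<open>By \<open>cos_square_eq\<close> the sign of \<open>gram\<close> alone decides whether
  the unclamped cosine leaves the open interval from -1 to 1, so all six angles of a tetrahedron
  saturate together.\<close>

lemma angle_boundary:
  assumes "tri a b d > 0" "tri a c e > 0" "a > 1" "gram a b c d e f \<le> 0"
  shows "angle a b c d e f \<in> {0, pi}"
proof -
  have "(a\<^sup>2 - 1) * gram a b c d e f / (tri a b d * tri a c e) \<le> 0"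
    using assms by (intro divide_nonpos_pos mult_nonneg_nonpos mult_pos_pos) auto
  then show ?thesis
    unfolding cos_square_eq[OF assms(1,2), symmetric] angle_def
    by (intro clamp_arccos_boundary) simp
qed

section \<open>Passage from labelled tetrahedra to the six cosh variables\<close>

lemma ext_dihedral_angle_conv_angle:
  assumes "{i, j, k, h} = (UNIV :: 4 set)"
  shows "ext_dihedral_angle l {i, j} = angle (cosh (l {i, j})) (cosh (l {i, k})) (cosh (l {i, h}))
    (cosh (l {j, k})) (cosh (l {j, h})) (cosh (l {k, h}))"
  unfolding ext_dihedral_angle_eq[OF assms] dihedral_cos_def Let_def angle_def clamp_arccos_def
    num_def tri_def sinh_square_eq ..

lemma edge_cases:
  assumes "card (s :: 4 set) = 2"
  obtains i j k h where "s = {i, j}" "{i, j, k, h} = UNIV" "i \<noteq> j" "i \<noteq> k" "i \<noteq> h" "j \<noteq> k" "j \<noteq> h" "k \<noteq> h"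
proof -
  obtain i j where ij: "s = {i, j}" "i \<noteq> j"
    using assms unfolding card_2_iff by blast
  have "card (- s) = 2"
    using assms by (simp add: Compl_eq_Diff_UNIV card_Diff_subset)
  then obtain k h where kh: "- s = {k, h}" "k \<noteq> h"
    unfolding card_2_iff by blast
  have "k \<notin> s" "h \<notin> s"
    using kh(1) by blast+
  then have ne: "i \<noteq> k" "i \<noteq> h" "j \<noteq> k" "j \<noteq> h"
    unfolding ij(1) by blast+
  have "{i, j, k, h} = s \<union> - s"
    unfolding kh(1) unfolding ij(1) by blast
  then have "{i, j, k, h} = UNIV"
    by simp
  then show thesis
    using that ij kh(2) ne by blast
qed

lemma edges_eq: "{s :: 4 set. card s = 2} = {{1, 2}, {1, 3}, {1, 4}, {2, 3}, {2, 4}, {3, 4}}" (is "_ = ?E")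
proof (intro equalityI subsetI)
  fix s :: "4 set" assume "s \<in> {s. card s = 2}"
  then obtain i j where "s = {i, j}" "i \<noteq> j"
    unfolding mem_Collect_eq card_2_iff by blast
  then show "s \<in> ?E"
    using exhaust_4[of i] exhaust_4[of j] by (elim disjE) (simp_all add: doubleton_eq_iff)
next
  fix s :: "4 set" assume "s \<in> ?E"
  then show "s \<in> {s. card s = 2}"
    by (elim insertE emptyE) simp_all
qed

lemma sum_edges:
  "(\<Sum>s | card s = 2. F s) = F {1, 2} + F {1, 3} + F {1, 4} + F {2, 3} + F {2, 4} + F {3, 4 :: 4}"
  unfolding edges_eq by (simp add: doubleton_eq_iff add.assoc)

lemma ext_dihedral_angle_bounds:
  assumes "card s = 2"
  shows "0 \<le> ext_dihedral_angle l s" "ext_dihedral_angle l s \<le> pi"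
  using assms by (auto elim!: edge_cases simp: ext_dihedral_angle_conv_angle angle_def clamp_arccos_bounds)

lemma tri_cosh_pos: "tri (cosh x) (cosh y) (cosh z) > 0"
  using tri_bounds(1)[of "cosh x" "cosh y" "cosh z" "max (cosh x) (max (cosh y) (cosh z))"]
  by (simp add: cosh_real_ge_1 le_max_iff_disj)

lemma continuous_on_ext_dihedral_angle:
  assumes "\<And>s. card s = 2 \<Longrightarrow> continuous_on S (\<lambda>x. l x s)" and "card s = 2"
  shows "continuous_on S (\<lambda>x. ext_dihedral_angle (l x) s)"
proof -
  obtain i j k h where ij: "s = {i, j}" and ijkh: "{i, j, k, h} = (UNIV :: 4 set)"
    and ne: "i \<noteq> j" "i \<noteq> k" "i \<noteq> h" "j \<noteq> k" "j \<noteq> h" "k \<noteq> h"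
    using edge_cases[OF assms(2)] .
  have c: "continuous_on S (\<lambda>x. cosh (l x {a, b}))" if "a \<noteq> b" for a b
    using that assms(1)[of "{a, b}"] by (intro continuous_on_cosh) simp
  show ?thesis
    unfolding ij ext_dihedral_angle_conv_angle[OF ijkh] angle_def
    by (intro continuous_intros) 
      (use tri_cosh_pos in \<open>auto simp: num_def tri_def less_imp_neq[symmetric] intro!: continuous_intros c ne\<close>)
qed

text \<open>There are 6 squares and 7 doubled products, each at most \<open>M ^ 4\<close> after
  padding with factors 1. The total 20 is rounded up to 25 so that the square root is
  \<open>5 * M\<^sup>2\<close>.\<close>

lemma gram_le:
  assumes "1 \<le> a" "1 \<le> b" "1 \<le> c" "1 \<le> d" "1 \<le> e" "1 \<le> f"
    and "a \<le> M" "b \<le> M" "c \<le> M" "d \<le> M" "e \<le> M" "f \<le> M"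
  shows "gram a b c d e f \<le> 25 * M ^ 4"
proof -
  have M: "M \<ge> 1"
    using assms by simp
  have 2: "x * y \<le> M\<^sup>2" if "1 \<le> x" "1 \<le> y" "x \<le> M" "y \<le> M" for x y
    unfolding power2_eq_square using that by (intro mult_mono) auto
  have 4: "x * y * z * w \<le> M ^ 4" if "1 \<le> x" "1 \<le> y" "1 \<le> z" "1 \<le> w" "x \<le> M" "y \<le> M" "z \<le> M"
    "w \<le> M" for x y z w
  proof -
    have "(x * y) * (z * w) \<le> M\<^sup>2 * M\<^sup>2"
      using that by (intro mult_mono 2) auto
    then show ?thesis
      by (simp add: mult.assoc flip: power_add)
  qed
  define T where "T = a * a * 1 * 1 + b * b * 1 * 1 + c * c * 1 * 1 + d * d * 1 * 1 + e * e * 1 * 1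
    + f * f * 1 * 1 + 2 * (a * b * d * 1) + 2 * (a * c * e * 1) + 2 * (b * c * f * 1)
    + 2 * (d * e * f * 1) + 2 * (a * f * b * e) + 2 * (a * f * c * d) + 2 * (b * e * c * d)"
  have "gram a b c d e f = T - (1 + (a * f)\<^sup>2 + (b * e)\<^sup>2 + (c * d)\<^sup>2)"
    by (simp add: gram_def T_def power_mult_distrib) (simp add: power2_eq_square)
  also have "\<dots> \<le> T"
    using zero_le_power2[of "a * f"] zero_le_power2[of "b * e"] zero_le_power2[of "c * d"] by linarith
  also have "T \<le> M ^ 4 + M ^ 4 + M ^ 4 + M ^ 4 + M ^ 4 + M ^ 4 + 2 * M ^ 4 + 2 * M ^ 4 + 2 * M ^ 4
    + 2 * M ^ 4 + 2 * M ^ 4 + 2 * M ^ 4 + 2 * M ^ 4"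
    unfolding T_def by (intro add_mono mult_left_mono 4 assms M order_refl) simp_all
  also have "\<dots> \<le> 25 * M ^ 4"
    using M by simp
  finally show ?thesis .
qed

text \<open>The constant collects 300 and \<open>M ^ 8\<close> from \<open>rates_ge\<close>,
  \<open>M\<^sup>2\<close> from \<open>sinh\<close> in the passage from lengths to their cosh, and
  \<open>5 * M\<^sup>2\<close> from the bound on \<open>sqrt (D t)\<close>.\<close>

lemma ext_dihedral_angle_one_sided_Lipschitz:
  fixes v w :: "4 set \<Rightarrow> real"
  assumes v: "\<And>s. card s = 2 \<Longrightarrow> 0 < v s \<and> v s \<le> B" and w: "\<And>s. card s = 2 \<Longrightarrow> 0 < w s \<and> w s \<le> B"
  shows "(\<Sum>s | card s = 2. (ext_dihedral_angle w s - ext_dihedral_angle v s) * (w s - v s))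
    \<ge> - (1500 * cosh B ^ 12) * (\<Sum>s | card s = 2. (w s - v s)\<^sup>2)"
proof -
  define M where "M = cosh B"
  define x where "x s = w s - v s" for s
  define X where "X = (\<Sum>s | card s = 2. (x s)\<^sup>2)"
  define u where "u t s = v s + t * x s" for t s
  define g where "g t = (\<Sum>s | card s = 2. ext_dihedral_angle (u t) s * x s)" for t
  \<comment> \<open>All values that \<open>g\<close> could take when every angle is 0 or
    \<open>pi\<close>. The set is finite because the direction \<open>x\<close> does not depend on
    \<open>t\<close>.\<close>
  define F where "F = (\<lambda>y. \<Sum>s | card s = 2. y s * x s) ` ({s. card s = 2} \<rightarrow>\<^sub>E {0, pi})"
  define c where "c s t = cosh (u t s)" for s t
  define D where "D t = gram (c {1,2} t) (c {1,3} t) (c {1,4} t) (c {2,3} t) (c {2,4} t) (c {3,4} t)" for t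
  have M1: "M \<ge> 1"
    by (simp add: M_def cosh_real_ge_1)
  have X: "X \<ge> 0"
    unfolding X_def by (intro sum_nonneg) auto
  have u_pos: "0 < u t s" "u t s \<le> B" if "card s = 2" "t \<in> {0<..<1}" for s t
  proof -
    have "u t s = (1 - t) * v s + t * w s"
      by (simp add: u_def x_def algebra_simps)
    moreover have "0 < (1 - t) * v s" "0 < t * w s" "(1 - t) * v s \<le> (1 - t) * B" "t * w s \<le> t * B"
      using that v[of s] w[of s] by (auto intro: mult_left_mono)
    ultimately show "0 < u t s" "u t s \<le> B"
      by (auto simp: algebra_simps)
  qed
  have c_bounds: "1 < c s t" "c s t \<le> M" if "card s = 2" "t \<in> {0<..<1}" for s t
    using u_pos[OF that] cosh_real_nonneg_less_iff[of 0 "u t s"] cosh_real_nonneg_le_iff[of "u t s" B]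
    by (simp_all add: c_def M_def)
  have angle_eq: "ext_dihedral_angle (u t) {i, j} = angle (c {i, j} t) (c {i, k} t) (c {i, h} t) (c {j, k} t) (c {j, h} t) (c {k, h} t)"
    if "{i, j, k, h} = UNIV" for i j k h t
    using ext_dihedral_angle_conv_angle[OF that] by (simp add: c_def)
  have U: "{1, 2, 3, 4} = (UNIV :: 4 set)" "{1, 3, 2, 4} = (UNIV :: 4 set)" "{1, 4, 2, 3} = (UNIV :: 4 set)"
    "{2, 3, 1, 4} = (UNIV :: 4 set)" "{2, 4, 1, 3} = (UNIV :: 4 set)" "{3, 4, 1, 2} = (UNIV :: 4 set)"
    by (auto simp: UNIV_4)
  have e: "{2, 1} = {1, 2 :: 4}" "{3, 1} = {1, 3 :: 4}" "{4, 1} = {1, 4 :: 4}" "{3, 2} = {2, 3 :: 4}"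
    "{4, 2} = {2, 4 :: 4}" "{4, 3} = {3, 4 :: 4}"
    by auto
  note angles = angle_eq[OF U(1)] angle_eq[OF U(2), unfolded e] angle_eq[OF U(3), unfolded e]
    angle_eq[OF U(4), unfolded e] angle_eq[OF U(5), unfolded e] angle_eq[OF U(6), unfolded e]
  have gram_perm:
    "gram (c {1, 2} t) (c {1, 3} t) (c {1, 4} t) (c {2, 3} t) (c {2, 4} t) (c {3, 4} t) = D t"
    "gram (c {1, 3} t) (c {1, 2} t) (c {1, 4} t) (c {2, 3} t) (c {3, 4} t) (c {2, 4} t) = D t"
    "gram (c {1, 4} t) (c {1, 2} t) (c {1, 3} t) (c {2, 4} t) (c {3, 4} t) (c {2, 3} t) = D t"
    "gram (c {2, 3} t) (c {1, 2} t) (c {2, 4} t) (c {1, 3} t) (c {3, 4} t) (c {1, 4} t) = D t"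
    "gram (c {2, 4} t) (c {1, 2} t) (c {2, 3} t) (c {1, 4} t) (c {3, 4} t) (c {1, 3} t) = D t"
    "gram (c {3, 4} t) (c {1, 3} t) (c {2, 3} t) (c {1, 4} t) (c {2, 4} t) (c {1, 2} t) = D t"
    for t
    by (simp_all add: D_def gram_def algebra_simps)
  have tri_c: "tri (c s t) (c s' t) (c s'' t) > 0" for s s' s'' t
    by (simp add: c_def tri_cosh_pos)
  have "g 1 \<ge> g 0 - (1500 * M ^ 12 * X) * (1 - 0)"
  proof (rule ge_of_deriv_ge_except_finite_range)
    show "finite F"
      unfolding F_def by (intro finite_imageI finite_PiE) auto
    show "continuous_on {0..1} g"
      unfolding g_def u_def by (intro continuous_intros continuous_on_ext_dihedral_angle) auto
    show "0 \<le> 1500 * M ^ 12 * X"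
      using M1 X by simp
    fix t :: real assume t: "t \<in> {0<..<1}"
    show "g t \<in> F \<or> (\<exists>g'. - (1500 * M ^ 12 * X) \<le> g' \<and> (g has_real_derivative g') (at t))"
    proof (cases "D t > 0")
      case False
      have "ext_dihedral_angle (u t) s \<in> {0, pi}" if "card s = 2" for s
      proof -
        have "s \<in> {{1, 2}, {1, 3}, {1, 4}, {2, 3}, {2, 4}, {3, 4}}"
          using that edges_eq by blast
        then show ?thesis
          using False c_bounds(1)[OF _ t]
          by (elim insertE emptyE; hypsubst; subst angles; intro angle_boundary tri_c) (simp_all add: gram_perm)
      qed
      then have "g t \<in> F"
        unfolding F_def g_def
        by (intro image_eqI[of _ _ "restrict (ext_dihedral_angle (u t)) {s. card s = 2}"]) auto
      then show ?thesis ..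
    next
      case True
      define c' where "c' s = sinh (u t s) * x s" for s
      have c': "(c s has_real_derivative c' s) (at t)" for s
        unfolding c_def u_def c'_def by (auto intro!: derivative_eq_intros)
      have c'_sq: "(c' s)\<^sup>2 \<le> M\<^sup>2 * (x s)\<^sup>2" if "card s = 2" for s
      proof -
        have "(c s t)\<^sup>2 \<le> M\<^sup>2"
          using c_bounds[OF that t] by (intro power_mono) auto
        then have "(sinh (u t s))\<^sup>2 \<le> M\<^sup>2"
          unfolding sinh_square_eq c_def by linarith
        then show ?thesis
          by (simp add: c'_def power_mult_distrib mult_right_mono)
      qed
      have scale: "y / (sqrt ((c s t)\<^sup>2 - 1) * sqrt (D t)) * x s = (c' s * y / ((c s t)\<^sup>2 - 1)) / sqrt (D t)"
        if "card s = 2" for y s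
      proof -
        have "sinh (u t s) > 0" "(c s t)\<^sup>2 - 1 = (sinh (u t s))\<^sup>2"
          using u_pos[OF that t] by (simp_all add: c_def sinh_square_eq)
        then show ?thesis
          by (simp add: c'_def power2_eq_square)
      qed
      let ?r = "\<lambda>e1 e2 e3 e4 e5 e6. rate (c e1 t) (c e2 t) (c e3 t) (c e4 t) (c e5 t) (c e6 t)
        (c' e1) (c' e2) (c' e3) (c' e4) (c' e5) (c' e6)"
      define q where "q = c' {1,2} * ?r {1,2} {1,3} {1,4} {2,3} {2,4} {3,4} / ((c {1,2} t)\<^sup>2 - 1)
        + c' {1,3} * ?r {1,3} {1,2} {1,4} {2,3} {3,4} {2,4} / ((c {1,3} t)\<^sup>2 - 1)
        + c' {1,4} * ?r {1,4} {1,2} {1,3} {2,4} {3,4} {2,3} / ((c {1,4} t)\<^sup>2 - 1)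
        + c' {2,3} * ?r {2,3} {1,2} {2,4} {1,3} {3,4} {1,4} / ((c {2,3} t)\<^sup>2 - 1)
        + c' {2,4} * ?r {2,4} {1,2} {2,3} {1,4} {3,4} {1,3} / ((c {2,4} t)\<^sup>2 - 1)
        + c' {3,4} * ?r {3,4} {1,3} {2,3} {1,4} {2,4} {1,2} / ((c {3,4} t)\<^sup>2 - 1)"
      have deriv: "((\<lambda>t. angle (c e1 t) (c e2 t) (c e3 t) (c e4 t) (c e5 t) (c e6 t) * x e1) has_real_derivative
          (c' e1 * ?r e1 e2 e3 e4 e5 e6 / ((c e1 t)\<^sup>2 - 1)) / sqrt (D t)) (at t)"
        if "card e1 = 2"
          "gram (c e1 t) (c e2 t) (c e3 t) (c e4 t) (c e5 t) (c e6 t) = D t" for e1 e2 e3 e4 e5 e6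
        using DERIV_cmult_right[OF DERIV_angle[OF c'[of e1] c'[of e2] c'[of e3] c'[of e4] c'[of e5] c'[of e6]
          tri_c tri_c c_bounds(1)[OF that(1) t]], of "x e1"] True
        unfolding that(2) scale[OF that(1)] by simp
      have "(g has_real_derivative q / sqrt (D t)) (at t)"
        unfolding g_def sum_edges angles q_def add_divide_distrib
        by (intro DERIV_add deriv) (simp_all add: gram_perm)
      moreover have "q / sqrt (D t) \<ge> - (1500 * M ^ 12 * X)"
      proof -
        have "q \<ge> - 300 * M ^ 8 * D t * ((c' {1,2})\<^sup>2 + (c' {1,3})\<^sup>2 + (c' {1,4})\<^sup>2 + (c' {2,3})\<^sup>2 + (c' {2,4})\<^sup>2 + (c' {3,4})\<^sup>2)"
          using rates_ge[OF c_bounds(1)[OF _ t] c_bounds(1)[OF _ t] c_bounds(1)[OF _ t]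
            c_bounds(1)[OF _ t] c_bounds(1)[OF _ t] c_bounds(1)[OF _ t]
            c_bounds(2)[OF _ t] c_bounds(2)[OF _ t] c_bounds(2)[OF _ t]
            c_bounds(2)[OF _ t] c_bounds(2)[OF _ t] c_bounds(2)[OF _ t],
            of "{1,2}" "{1,3}" "{1,4}" "{2,3}" "{2,4}" "{3,4}"
               "c' {1,2}" "c' {1,3}" "c' {1,4}" "c' {2,3}" "c' {2,4}" "c' {3,4}"] True
          unfolding q_def D_def by simp
        moreover have "(c' {1,2})\<^sup>2 + (c' {1,3})\<^sup>2 + (c' {1,4})\<^sup>2 + (c' {2,3})\<^sup>2 + (c' {2,4})\<^sup>2 + (c' {3,4})\<^sup>2 \<le> M\<^sup>2 * X"
          unfolding X_def sum_edges distrib_left by (intro add_mono c'_sq) auto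
        then have "300 * M ^ 8 * D t * ((c' {1,2})\<^sup>2 + (c' {1,3})\<^sup>2 + (c' {1,4})\<^sup>2 + (c' {2,3})\<^sup>2 + (c' {2,4})\<^sup>2 + (c' {3,4})\<^sup>2)
          \<le> 300 * M ^ 8 * D t * (M\<^sup>2 * X)"
          using M1 True by (intro mult_left_mono) auto
        ultimately have "q \<ge> - (300 * M ^ 8 * D t * (M\<^sup>2 * X))"
          by simp
        then have "q / sqrt (D t) \<ge> - (300 * M ^ 8 * D t * (M\<^sup>2 * X)) / sqrt (D t)"
          using True by (intro divide_right_mono) auto
        also have "- (300 * M ^ 8 * D t * (M\<^sup>2 * X)) / sqrt (D t) = - (300 * M ^ 8 * (M\<^sup>2 * X)) * (D t / sqrt (D t))"
          by simp
        also have "D t / sqrt (D t) = sqrt (D t)"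
          using True by (simp add: real_div_sqrt)
        finally have "q / sqrt (D t) \<ge> - (300 * M ^ 8 * (M\<^sup>2 * X) * sqrt (D t))"
          by simp
        moreover have "sqrt (D t) \<le> 5 * M\<^sup>2"
        proof (rule real_le_lsqrt)
          have "D t \<le> 25 * M ^ 4"
            unfolding D_def by (intro gram_le less_imp_le[OF c_bounds(1)] c_bounds(2) t) auto
          then show "D t \<le> (5 * M\<^sup>2)\<^sup>2"
            by (simp add: power_mult_distrib flip: power_mult)
        qed (use M1 in auto)
        then have "300 * M ^ 8 * (M\<^sup>2 * X) * sqrt (D t) \<le> 300 * M ^ 8 * (M\<^sup>2 * X) * (5 * M\<^sup>2)"
          using M1 X by (intro mult_left_mono) auto
        moreover have "300 * M ^ 8 * (M\<^sup>2 * X) * (5 * M\<^sup>2) = 1500 * M ^ 12 * X"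
          by (simp add: power_add[of M 10 2, simplified] power_add[of M 8 2, simplified])
        ultimately show ?thesis
          by linarith
      qed
      ultimately show ?thesis
        by blast
    qed
  qed simp
  moreover have u01: "u 0 = v" "u 1 = w"
    by (auto simp: u_def x_def)
  have "(\<Sum>s | card s = 2. (ext_dihedral_angle w s - ext_dihedral_angle v s) * x s) = g 1 - g 0"
    unfolding g_def u01 left_diff_distrib sum_subtractf ..
  ultimately have "(\<Sum>s | card s = 2. (ext_dihedral_angle w s - ext_dihedral_angle v s) * x s) \<ge> - (1500 * M ^ 12) * X"
    by simp
  then show ?thesis
    unfolding M_def X_def x_def .
qed

subsection \<open>Peano's existence theorem\<close>

primrec euler :: "('a::real_vector \<Rightarrow> 'a) \<Rightarrow> real \<Rightarrow> 'a \<Rightarrow> nat \<Rightarrow> 'a"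
  where "euler f h x 0 = x"
  | "euler f h x (Suc n) = euler f h x n + h *\<^sub>R f (euler f h x n)"

definition polygon :: "('a::real_vector \<Rightarrow> 'a) \<Rightarrow> real \<Rightarrow> 'a \<Rightarrow> real \<Rightarrow> 'a"
  where "polygon f h x t =
    (let k = nat \<lfloor>t / h\<rfloor> in euler f h x k + (t - real k * h) *\<^sub>R f (euler f h x k))"

lemma polygon_node: "h > 0 \<Longrightarrow> polygon f h x (real k * h) = euler f h x k"
  by (simp add: polygon_def)

lemma euler_increment:
  fixes f :: "'a::real_normed_vector \<Rightarrow> 'a"
  assumes "i \<le> j" "h > 0" "\<And>k. i \<le> k \<Longrightarrow> k < j \<Longrightarrow> norm (f (euler f h x k) - w) \<le> m"
  shows "norm (euler f h x j - euler f h x i - ((real j - real i) * h) *\<^sub>R w) \<le> m * ((real j - real i) * h)"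
  using assms(1,3)
proof (induction j rule: dec_induct)
  case (step n)
  let ?e = "euler f h x"
  have "?e (Suc n) - ?e i - ((real (Suc n) - real i) * h) *\<^sub>R w
    = (?e n - ?e i - ((real n - real i) * h) *\<^sub>R w) + h *\<^sub>R (f (?e n) - w)"
    by (simp add: algebra_simps)
  also have "norm \<dots> \<le> m * ((real n - real i) * h) + h * m"
    using step assms(2) by (intro norm_triangle_mono) (auto intro!: mult_left_mono)
  finally show ?case
    by (simp add: algebra_simps)
qed simp

text \<open>The slope condition concerns only the grid cells that meet the interval from
  \<open>s\<close> to \<open>t\<close>. With \<open>w = 0\<close> this yields equicontinuity of the
  polygons; with \<open>w\<close> the slope at a limit point it yields differentiability of the
  limit.\<close>

lemma polygon_increment:
  fixes f :: "'a::real_normed_vector \<Rightarrow> 'a"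
  assumes "h > 0" "0 \<le> s" "s \<le> t"
    and m: "\<And>k. real k * h \<le> t \<Longrightarrow> s < real k * h + h \<Longrightarrow> norm (f (euler f h x k) - w) \<le> m"
  shows "norm (polygon f h x t - polygon f h x s - (t - s) *\<^sub>R w) \<le> m * (t - s)"
proof -
  define i j where "i = nat \<lfloor>s / h\<rfloor>" and "j = nat \<lfloor>t / h\<rfloor>"
  let ?e = "euler f h x"
  have cell: "real (nat \<lfloor>r / h\<rfloor>) * h \<le> r" "r < real (nat \<lfloor>r / h\<rfloor>) * h + h" if "0 \<le> r" for r
  proof -
    have "real (nat \<lfloor>r / h\<rfloor>) \<le> r / h" "r / h < real (nat \<lfloor>r / h\<rfloor>) + 1"
      using that assms(1) by (simp_all add: of_nat_nat)
    then show "real (nat \<lfloor>r / h\<rfloor>) * h \<le> r" "r < real (nat \<lfloor>r / h\<rfloor>) * h + h"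
      using assms(1) by (simp_all add: field_simps)
  qed
  have i: "real i * h \<le> s" "s < real i * h + h" and j: "real j * h \<le> t" "t < real j * h + h"
    using cell[of s] cell[of t] assms by (simp_all add: i_def j_def)
  have P: "polygon f h x s = ?e i + (s - real i * h) *\<^sub>R f (?e i)"
    "polygon f h x t = ?e j + (t - real j * h) *\<^sub>R f (?e j)"
    by (simp_all add: polygon_def i_def j_def Let_def)
  have ij: "i \<le> j"
    unfolding i_def j_def using assms by (intro nat_mono floor_mono divide_right_mono) auto
  show ?thesis
  proof (cases "i = j")
    case True
    have "polygon f h x t - polygon f h x s - (t - s) *\<^sub>R w = (t - s) *\<^sub>R (f (?e j) - w)"
      by (simp add: P True algebra_simps)
    moreover have "norm (f (?e j) - w) \<le> m"
      using True i j assms by (intro m) auto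
    ultimately show ?thesis
      using assms(3) by (simp add: mult.commute[of m] mult_left_mono)
  next
    case False
    with ij have "Suc i \<le> j"
      by simp
    then have "real (Suc i) * h \<le> real j * h"
      using assms(1) by (intro mult_right_mono) auto
    then have sj: "real i * h + h \<le> real j * h"
      by (simp add: algebra_simps)
    have mid: "norm (?e j - ?e (Suc i) - ((real j - real (Suc i)) * h) *\<^sub>R w) \<le> m * ((real j - real (Suc i)) * h)"
    proof (rule euler_increment)
      fix k assume k: "Suc i \<le> k" "k < j"
      then have "real (Suc i) * h \<le> real k * h" "real k * h \<le> real j * h"
        using assms(1) by (intro mult_right_mono; simp)+
      then have "real k * h \<le> t" "s < real k * h + h"
        using i j assms(1) unfolding of_nat_Suc distrib_right by linarith+
      then show "norm (f (?e k) - w) \<le> m"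
        by (rule m)
    qed fact+
    have left: "norm ((real i * h + h - s) *\<^sub>R (f (?e i) - w)) \<le> (real i * h + h - s) * m"
      using i j sj assms by (auto intro!: mult_left_mono m)
    have right: "norm ((t - real j * h) *\<^sub>R (f (?e j) - w)) \<le> (t - real j * h) * m"
      using i j sj assms by (auto intro!: mult_left_mono m)
    have "polygon f h x t - polygon f h x s - (t - s) *\<^sub>R w
      = (t - real j * h) *\<^sub>R (f (?e j) - w) + (?e j - ?e (Suc i) - ((real j - real (Suc i)) * h) *\<^sub>R w)
        + (real i * h + h - s) *\<^sub>R (f (?e i) - w)"
      by (simp add: P algebra_simps)
    also have "norm \<dots> \<le> (t - real j * h) * m + m * ((real j - real (Suc i)) * h) + (real i * h + h - s) * m"
      by (intro norm_triangle_mono left right mid)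
    also have "\<dots> = m * (t - s)"
      by (simp add: algebra_simps)
    finally show ?thesis .
  qed
qed

lemma polygon_increment_abs:
  fixes f :: "'a::real_normed_vector \<Rightarrow> 'a"
  assumes "h > 0" "0 \<le> s" "0 \<le> t"
    and m: "\<And>k. real k * h \<le> max s t \<Longrightarrow> min s t < real k * h + h \<Longrightarrow> norm (f (euler f h x k) - w) \<le> m"
  shows "norm (polygon f h x t - polygon f h x s - (t - s) *\<^sub>R w) \<le> m * \<bar>t - s\<bar>"
proof (cases "s \<le> t")
  case True
  then show ?thesis
    using polygon_increment[of h s t f x w m] assms by simp
next
  case False
  have "polygon f h x t - polygon f h x s - (t - s) *\<^sub>R w = - (polygon f h x s - polygon f h x t - (s - t) *\<^sub>R w)"
    by (simp add: algebra_simps)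
  with False show ?thesis
    using polygon_increment[of h t s f x w m] assms by (simp only: norm_minus_cancel) simp
qed

text \<open>A subsequence of Euler polygons with step sizes tending to 0 converges uniformly. The
  derivative of the limit is read off directly from the increments of the polygons, without an
  integral equation. The global bound on \<open>f\<close> permits every length
  \<open>T\<close>.\<close>

theorem Peano_existence:
  fixes f :: "'a::{real_normed_vector,heine_borel} \<Rightarrow> 'a"
  assumes cont: "continuous_on UNIV f" and bound: "\<And>x. norm (f x) \<le> M" and "T \<ge> 0"
  obtains u where "u 0 = x" "\<And>t. t \<in> {0..T} \<Longrightarrow> (u has_vector_derivative f (u t)) (at t within {0..T})"
proof -
  define h where "h n = inverse (real (Suc n))" for n
  define F where "F n = polygon f (h n) x" for n
  have h: "h n > 0" for n
    by (simp add: h_def)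
  have M: "M \<ge> 0"
    using bound[of x] norm_ge_zero order.trans by blast
  have lip: "norm (F n t - F n s) \<le> M * \<bar>t - s\<bar>" if "0 \<le> s" "0 \<le> t" for n s t
    using polygon_increment_abs[OF h[of n] that, of f x 0 M] bound by (simp add: F_def)
  have F0: "F n 0 = x" for n
    by (simp add: F_def polygon_def)
  obtain g k where k: "strict_mono (k :: nat \<Rightarrow> nat)"
    and unif: "\<And>e. 0 < e \<Longrightarrow> \<exists>N. \<forall>n t. n \<ge> N \<and> t \<in> {0..T} \<longrightarrow> norm (F (k n) t - g t) < e"
  proof (rule Arzela_Ascoli[of "{0..T}" F "norm x + M * T"])
    show "norm (F n t) \<le> norm x + M * T" if "t \<in> {0..T}" for n t
    proof -
      have "norm (F n t) \<le> norm (F n 0) + norm (F n t - F n 0)"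
        by (rule norm_triangle_sub)
      also have "norm (F n t - F n 0) \<le> M * T"
        using lip[of 0 t n] that M by (auto intro: order.trans mult_left_mono)
      finally show ?thesis
        by (simp add: F0)
    qed
    show "\<exists>d>0. \<forall>n s. s \<in> {0..T} \<and> norm (t - s) < d \<longrightarrow> norm (F n t - F n s) < e"
      if "t \<in> {0..T}" "0 < e" for t e
    proof (intro exI[of _ "e / (M + 1)"] conjI allI impI)
      show "0 < e / (M + 1)"
        using that M by simp
      fix n s assume s: "s \<in> {0..T} \<and> norm (t - s) < e / (M + 1)"
      have "norm (F n t - F n s) \<le> M * \<bar>t - s\<bar>"
        using lip s that by simp
      also have "\<dots> \<le> (M + 1) * \<bar>t - s\<bar>"
        by (intro mult_right_mono) auto
      also have "\<dots> < e"
        using s M by (simp add: field_simps)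
      finally show "norm (F n t - F n s) < e" .
    qed
  qed (use that in auto)
  have lim: "(\<lambda>n. F (k n) t) \<longlonglongrightarrow> g t" if "t \<in> {0..T}" for t
    using unif that unfolding LIMSEQ_iff by blast
  have "g 0 = x"
    using lim[of 0] \<open>T \<ge> 0\<close> by (simp add: F0 LIMSEQ_const_iff)
  moreover have "(g has_vector_derivative f (g t)) (at t within {0..T})" if t: "t \<in> {0..T}" for t
    unfolding has_vector_derivative_def has_derivative_within_alt
  proof (intro conjI allI impI bounded_linear_scaleR_left)
    fix e :: real assume "e > 0"
    then obtain r where r: "r > 0" "\<And>y. norm (y - g t) < r \<Longrightarrow> norm (f y - f (g t)) < e"
      using cont unfolding continuous_on_iff by (metis UNIV_I dist_norm)
    \<comment> \<open>The nodes used below lie within \<open>2 * d\<close> of \<open>t\<close>, by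
      mesh less than \<open>d\<close> and \<open>s\<close> within \<open>d\<close> of
      \<open>t\<close>. A polygon moves by less than \<open>2 * (r / 3)\<close> over that distance,
      and the last third of \<open>r\<close> is left for its convergence at \<open>t\<close>.
      \<open>M + 1\<close> avoids dividing by 0.\<close>
    define d where "d = r / (3 * (M + 1))"
    have d: "d > 0" "M * d < r / 3"
      using r(1) M by (auto simp: d_def field_simps)
    have hk: "(\<lambda>n. h (k n)) \<longlonglongrightarrow> 0"
      using LIMSEQ_subseq_LIMSEQ[OF LIMSEQ_inverse_real_of_nat k] by (simp add: h_def o_def)
    have "norm (g s - g t - (s - t) *\<^sub>R f (g t)) \<le> e * norm (s - t)"
      if s: "s \<in> {0..T}" "norm (s - t) < d" for s
    proof (rule tendsto_upperbound)
      show "(\<lambda>n. norm (F (k n) s - F (k n) t - (s - t) *\<^sub>R f (g t)))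
        \<longlonglongrightarrow> norm (g s - g t - (s - t) *\<^sub>R f (g t))"
        by (intro tendsto_intros lim s t)
      have "\<forall>\<^sub>F n in sequentially. h (k n) < d"
        using hk d by (intro order_tendstoD(2))
      moreover have "\<forall>\<^sub>F n in sequentially. norm (F (k n) t - g t) < r / 3"
        using lim[OF t] r(1) by (intro order_tendstoD(2)[of _ 0] tendsto_norm_zero LIM_zero) auto
      ultimately show "\<forall>\<^sub>F n in sequentially. norm (F (k n) s - F (k n) t - (s - t) *\<^sub>R f (g t)) \<le> e * norm (s - t)"
      proof eventually_elim
        case (elim n)
        have "norm (f (euler f (h (k n)) x i) - f (g t)) \<le> e"
          if i: "real i * h (k n) \<le> max t s" "min t s < real i * h (k n) + h (k n)" for i
        proof -
          let ?\<tau> = "real i * h (k n)"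
          have "\<bar>?\<tau> - t\<bar> \<le> 2 * d"
            using i s elim(1) by (auto simp: abs_if max_def min_def split: if_splits)
          then have "norm (F (k n) ?\<tau> - F (k n) t) \<le> M * (2 * d)"
            using lip[of t ?\<tau> "k n"] t h[of "k n"] M by (auto intro: order.trans mult_left_mono)
          also have "\<dots> < 2 * (r / 3)"
            using d(2) by simp
          finally have "norm ((F (k n) ?\<tau> - F (k n) t) + (F (k n) t - g t)) < 2 * (r / 3) + r / 3"
            using elim(2) by (intro norm_triangle_lt) auto
          then have "norm (f (F (k n) ?\<tau>) - f (g t)) < e"
            by (intro r(2)) simp
          then show ?thesis
            using polygon_node[OF h[of "k n"], of f x i] by (simp add: F_def)
        qed
        then show ?case
          using polygon_increment_abs[OF h[of "k n"], of t s f x "f (g t)" e] s t by (simp add: F_def)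
      qed
    qed simp
    with d(1) show "\<exists>d>0. \<forall>s\<in>{0..T}. norm (s - t) < d \<longrightarrow>
        norm (g s - g t - (s - t) *\<^sub>R f (g t)) \<le> e * norm (s - t)"
      by blast
  qed
  ultimately show thesis
    by (rule that)
qed

subsection \<open>The extended Ricci flow\<close>

lemma ext_dihedral_angle_cong:
  assumes "\<And>s. card s = 2 \<Longrightarrow> l s = l' s" "card s = 2"
  shows "ext_dihedral_angle l s = ext_dihedral_angle l' s"
proof -
  obtain i j k h where ij: "s = {i, j}" and ijkh: "{i, j, k, h} = (UNIV :: 4 set)"
    and ne: "i \<noteq> j" "i \<noteq> k" "i \<noteq> h" "j \<noteq> k" "j \<noteq> h" "k \<noteq> h"
    using edge_cases[OF assms(2)] .
  have "l {a, b} = l' {a, b}" if "a \<noteq> b" for a b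
    using that assms(1)[of "{a, b}"] by simp
  then show ?thesis
    unfolding ij ext_dihedral_angle_conv_angle[OF ijkh] by (simp only: ne not_False_eq_True)
qed

lemma edge_proj_in_edge_set: "card s = 2 \<Longrightarrow> edge_proj T (j, s) \<in> edge_set T"
  unfolding edge_proj_def edge_set_def by (intro quotientI) (simp add: tet_edges_def)

lemma ext_curvature_cong:
  assumes "\<And>e. e \<in> edge_set T \<Longrightarrow> l e = l' e"
  shows "ext_curvature T l e = ext_curvature T l' e"
  unfolding ext_curvature_def
  by (intro arg_cong2[of _ _ _ _ "(-)"] sum.cong refl)
    (auto simp: tet_edges_def assms edge_proj_in_edge_set intro!: ext_dihedral_angle_cong)

lemma ext_curvature_bound:
  "\<bar>ext_curvature (T :: 'j::finite face_gluing) l e\<bar> \<le> 2 * pi + pi * card (tet_edges :: ('j \<times> 4 set) set)"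
proof -
  let ?A = "{x \<in> tet_edges. edge_proj T x = e}"
  let ?S = "\<Sum>(j, s) \<in> ?A. ext_dihedral_angle (\<lambda>s'. l (edge_proj T (j, s'))) s"
  have "0 \<le> ?S"
    by (intro sum_nonneg) (auto simp: tet_edges_def ext_dihedral_angle_bounds)
  moreover have "?S \<le> real (card ?A) * pi"
    by (intro sum_bounded_above) (auto simp: tet_edges_def ext_dihedral_angle_bounds)
  moreover have "real (card ?A) * pi \<le> real (card (tet_edges :: ('j \<times> 4 set) set)) * pi"
    by (intro mult_right_mono of_nat_mono card_mono) auto
  ultimately have "?S \<le> pi * card (tet_edges :: ('j \<times> 4 set) set)"
    by (simp only: mult.commute[of pi])
  with \<open>0 \<le> ?S\<close> show ?thesis
    unfolding ext_curvature_def using pi_ge_zero by linarith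
qed

lemma continuous_on_ext_curvature:
  assumes "\<And>e. e \<in> edge_set T \<Longrightarrow> continuous_on S (\<lambda>x. l x e)"
  shows "continuous_on S (\<lambda>x. ext_curvature T (l x) e)"
  unfolding ext_curvature_def case_prod_beta
  by (intro continuous_intros continuous_on_ext_dihedral_angle assms edge_proj_in_edge_set)
    (auto simp: tet_edges_def)

text \<open>Grouping the edges of the tetrahedra by their class turns the pairing over
  \<open>edge_set T\<close> into a sum of single-tetrahedron pairings, with the sign reversed since
  curvature is \<open>2 * pi\<close> minus angles.\<close>

lemma ext_curvature_one_sided_Lipschitz:
  fixes T :: "'j::finite face_gluing"
  assumes l: "\<And>e. e \<in> edge_set T \<Longrightarrow> 0 < l e \<and> l e \<le> B" and l': "\<And>e. e \<in> edge_set T \<Longrightarrow> 0 < l' e \<and> l' e \<le> B"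
  shows "(\<Sum>e\<in>edge_set T. (ext_curvature T l e - ext_curvature T l' e) * (l e - l' e))
    \<le> 1500 * cosh B ^ 12 * card (tet_edges :: ('j \<times> 4 set) set) * (\<Sum>e\<in>edge_set T. (l e - l' e)\<^sup>2)"
proof -
  let ?E = "tet_edges :: ('j \<times> 4 set) set"
  let ?p = "edge_proj T"
  define C where "C = 1500 * cosh B ^ 12"
  define \<alpha> where "\<alpha> m x = ext_dihedral_angle (\<lambda>s. m (?p (fst x, s))) (snd x)" for m x
  have C: "C \<ge> 0"
    by (simp add: C_def)
  have E: "?E = UNIV \<times> {s. card s = 2}"
    by (auto simp: tet_edges_def)
  have proj: "?p x \<in> edge_set T" if "x \<in> ?E" for x
    using that edge_proj_in_edge_set[of "snd x" T "fst x"] by (simp add: tet_edges_def case_prod_beta)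
  have K: "ext_curvature T m e = 2 * pi - (\<Sum>x | x \<in> ?E \<and> ?p x = e. \<alpha> m x)" for m e
    by (simp add: ext_curvature_def \<alpha>_def case_prod_beta)
  have "(\<Sum>e\<in>edge_set T. (ext_curvature T l e - ext_curvature T l' e) * (l e - l' e))
    = (\<Sum>e\<in>edge_set T. \<Sum>x | x \<in> ?E \<and> ?p x = e. - ((\<alpha> l x - \<alpha> l' x) * (l (?p x) - l' (?p x))))"
    unfolding K by (intro sum.cong refl)
      (simp add: sum_negf sum_subtractf[symmetric] sum_distrib_right left_diff_distrib[symmetric] minus_mult_left)
  also have "\<dots> = (\<Sum>x\<in>?E. - ((\<alpha> l x - \<alpha> l' x) * (l (?p x) - l' (?p x))))"
    using proj by (intro sum.group) auto
  also have "\<dots> = (\<Sum>j\<in>UNIV. \<Sum>s | card s = 2. - ((\<alpha> l (j, s) - \<alpha> l' (j, s)) * (l (?p (j, s)) - l' (?p (j, s)))))"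
    unfolding E by (simp add: sum.cartesian_product case_prod_beta)
  also have "\<dots> \<le> (\<Sum>j\<in>UNIV. \<Sum>s | card s = 2. C * (l (?p (j, s)) - l' (?p (j, s)))\<^sup>2)"
  proof (rule sum_mono)
    fix j
    show "(\<Sum>s | card s = 2. - ((\<alpha> l (j, s) - \<alpha> l' (j, s)) * (l (?p (j, s)) - l' (?p (j, s)))))
      \<le> (\<Sum>s | card s = 2. C * (l (?p (j, s)) - l' (?p (j, s)))\<^sup>2)"
      using ext_dihedral_angle_one_sided_Lipschitz[of "\<lambda>s. l' (?p (j, s))" B "\<lambda>s. l (?p (j, s))"]
        l l' edge_proj_in_edge_set[of _ T j]
      unfolding C_def[symmetric] sum_negf sum_distrib_left[symmetric] \<alpha>_def fst_conv snd_conv by simp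
  qed
  also have "\<dots> = C * (\<Sum>x\<in>?E. (l (?p x) - l' (?p x))\<^sup>2)"
    unfolding E by (simp add: sum.cartesian_product case_prod_beta sum_distrib_left)
  \<comment> \<open>Each tetrahedron edge contributes one term of the sum over classes; bounding
    every such term by the whole sum gives the factor \<open>card ?E\<close>.\<close>
  also have "\<dots> \<le> C * (card ?E * (\<Sum>e\<in>edge_set T. (l e - l' e)\<^sup>2))"
    using C by (intro mult_left_mono sum_bounded_above member_le_sum[of "?p _" _ "\<lambda>e. (l e - l' e)\<^sup>2"] proj) auto
  finally show ?thesis
    by (simp add: C_def mult.assoc)
qed

lemma ext_Ricci_flow_unique_on:
  fixes T :: "'j::finite face_gluing"
  assumes pos: "\<And>t e. t \<in> {0..b} \<Longrightarrow> e \<in> edge_set T \<Longrightarrow> 0 < l t e"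
      "\<And>t e. t \<in> {0..b} \<Longrightarrow> e \<in> edge_set T \<Longrightarrow> 0 < l' t e"
    and flow: "\<And>t e. t \<in> {0..b} \<Longrightarrow> e \<in> edge_set T \<Longrightarrow>
        ((\<lambda>\<tau>. l \<tau> e) has_real_derivative ext_curvature T (l t) e * l t e) (at t within {0..b})"
      "\<And>t e. t \<in> {0..b} \<Longrightarrow> e \<in> edge_set T \<Longrightarrow>
        ((\<lambda>\<tau>. l' \<tau> e) has_real_derivative ext_curvature T (l' t) e * l' t e) (at t within {0..b})"
    and init: "\<And>e. e \<in> edge_set T \<Longrightarrow> l 0 e = l' 0 e"
    and t: "t \<in> {0..b}" and e: "e \<in> edge_set T"
  shows "l t e = l' t e"
proof -
  let ?K = "ext_curvature T"
  have cont: "continuous_on {0..b} (\<lambda>\<tau>. l \<tau> e)" "continuous_on {0..b} (\<lambda>\<tau>. l' \<tau> e)" if "e \<in> edge_set T" for e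
    by (rule DERIV_continuous_on, erule flow[OF _ that])+
  obtain B where B: "\<And>\<tau> e. \<tau> \<in> {0..b} \<Longrightarrow> e \<in> edge_set T \<Longrightarrow> l \<tau> e \<le> B \<and> l' \<tau> e \<le> B"
  proof -
    have "bounded (\<Union>e\<in>edge_set T. (\<lambda>\<tau>. l \<tau> e) ` {0..b} \<union> (\<lambda>\<tau>. l' \<tau> e) ` {0..b})"
      by (intro bounded_UN) (auto intro!: compact_imp_bounded compact_continuous_image cont)
    then obtain B where "\<forall>y \<in> (\<Union>e\<in>edge_set T. (\<lambda>\<tau>. l \<tau> e) ` {0..b} \<union> (\<lambda>\<tau>. l' \<tau> e) ` {0..b}). norm y \<le> B"
      unfolding bounded_iff by blast
    then have "norm (l \<tau> e) \<le> B \<and> norm (l' \<tau> e) \<le> B" if "\<tau> \<in> {0..b}" "e \<in> edge_set T" for \<tau> e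
      using that by blast
    then have "l \<tau> e \<le> B \<and> l' \<tau> e \<le> B" if "\<tau> \<in> {0..b}" "e \<in> edge_set T" for \<tau> e
      using that by (simp add: abs_le_iff)
    then show thesis
      by (rule that)
  qed
  have "B \<ge> 0"
    using B[OF t e] pos(1)[OF t e] by simp
  define \<kappa> where "\<kappa> = 2 * pi + pi * card (tet_edges :: ('j \<times> 4 set) set)"
  define C where "C = 1500 * cosh B ^ 12 * card (tet_edges :: ('j \<times> 4 set) set)"
  \<comment> \<open>The part \<open>2 * C * B\<close> comes from the one-sided bound together with
    \<open>(l - l')\<^sup>2 \<le> B * ((l - l')\<^sup>2 / l)\<close>; the part
    \<open>3 * \<kappa>\<close> bounds the factor \<open>2 * K l' - K l\<close> that remains when
    the weighted square is differentiated.\<close>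
  define L where "L = 2 * C * B + 3 * \<kappa>"
  have C: "C \<ge> 0"
    by (simp add: C_def)
  have \<kappa>: "\<bar>?K m e\<bar> \<le> \<kappa>" for m e
    unfolding \<kappa>_def by (rule ext_curvature_bound)
  define \<Psi> where "\<Psi> \<tau> = (\<Sum>e\<in>edge_set T. (l \<tau> e - l' \<tau> e)\<^sup>2 / l \<tau> e)" for \<tau>
  define \<Psi>' where "\<Psi>' \<tau> = (\<Sum>e\<in>edge_set T. 2 * ((?K (l \<tau>) e - ?K (l' \<tau>) e) * (l \<tau> e - l' \<tau> e))
    + (l \<tau> e - l' \<tau> e)\<^sup>2 / l \<tau> e * (2 * ?K (l' \<tau>) e - ?K (l \<tau>) e))" for \<tau>
  have \<Psi>_deriv: "(\<Psi> has_real_derivative \<Psi>' \<tau>) (at \<tau> within {0..b})" if \<tau>: "\<tau> \<in> {0..b}" for \<tau>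
    unfolding \<Psi>_def \<Psi>'_def
  proof (rule DERIV_sum)
    fix e assume e: "e \<in> edge_set T"
    show "((\<lambda>\<tau>. (l \<tau> e - l' \<tau> e)\<^sup>2 / l \<tau> e) has_real_derivative
        2 * ((?K (l \<tau>) e - ?K (l' \<tau>) e) * (l \<tau> e - l' \<tau> e))
        + (l \<tau> e - l' \<tau> e)\<^sup>2 / l \<tau> e * (2 * ?K (l' \<tau>) e - ?K (l \<tau>) e)) (at \<tau> within {0..b})"
      by (rule derivative_eq_intros flow[OF \<tau> e] refl)+
        (use pos(1)[OF \<tau> e] in \<open>simp_all add: field_simps power2_eq_square\<close>)
  qed
  have \<Psi>'_le: "\<Psi>' \<tau> \<le> L * \<Psi> \<tau>" if \<tau>: "\<tau> \<in> {0..b}" for \<tau>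
  proof -
    have "(\<Sum>e\<in>edge_set T. (?K (l \<tau>) e - ?K (l' \<tau>) e) * (l \<tau> e - l' \<tau> e)) \<le> C * (\<Sum>e\<in>edge_set T. (l \<tau> e - l' \<tau> e)\<^sup>2)"
      unfolding C_def using pos B \<tau> by (intro ext_curvature_one_sided_Lipschitz) auto
    also have "\<dots> \<le> C * (B * \<Psi> \<tau>)"
      unfolding \<Psi>_def sum_distrib_left[of B]
    proof (intro mult_left_mono sum_mono C)
      fix e assume e: "e \<in> edge_set T"
      have "(l \<tau> e - l' \<tau> e)\<^sup>2 = l \<tau> e * ((l \<tau> e - l' \<tau> e)\<^sup>2 / l \<tau> e)"
        using pos(1)[OF \<tau> e] by simp
      also have "\<dots> \<le> B * ((l \<tau> e - l' \<tau> e)\<^sup>2 / l \<tau> e)"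
        using pos(1)[OF \<tau> e] B[OF \<tau> e] by (intro mult_right_mono) auto
      finally show "(l \<tau> e - l' \<tau> e)\<^sup>2 \<le> B * ((l \<tau> e - l' \<tau> e)\<^sup>2 / l \<tau> e)" .
    qed
    finally have 1: "(\<Sum>e\<in>edge_set T. (?K (l \<tau>) e - ?K (l' \<tau>) e) * (l \<tau> e - l' \<tau> e)) \<le> C * (B * \<Psi> \<tau>)" .
    have 2: "(\<Sum>e\<in>edge_set T. (l \<tau> e - l' \<tau> e)\<^sup>2 / l \<tau> e * (2 * ?K (l' \<tau>) e - ?K (l \<tau>) e)) \<le> \<Psi> \<tau> * (3 * \<kappa>)"
      unfolding \<Psi>_def sum_distrib_right
    proof (intro sum_mono mult_left_mono)
      fix e assume e: "e \<in> edge_set T"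
      show "2 * ?K (l' \<tau>) e - ?K (l \<tau>) e \<le> 3 * \<kappa>"
        using \<kappa>[of "l \<tau>" e] \<kappa>[of "l' \<tau>" e] by linarith
      show "0 \<le> (l \<tau> e - l' \<tau> e)\<^sup>2 / l \<tau> e"
        using pos(1)[OF \<tau> e] by simp
    qed
    have "\<Psi>' \<tau> = 2 * (\<Sum>e\<in>edge_set T. (?K (l \<tau>) e - ?K (l' \<tau>) e) * (l \<tau> e - l' \<tau> e))
      + (\<Sum>e\<in>edge_set T. (l \<tau> e - l' \<tau> e)\<^sup>2 / l \<tau> e * (2 * ?K (l' \<tau>) e - ?K (l \<tau>) e))"
      unfolding \<Psi>'_def by (simp only: sum.distrib sum_distrib_left)
    also have "\<dots> \<le> 2 * (C * (B * \<Psi> \<tau>)) + \<Psi> \<tau> * (3 * \<kappa>)"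
      using 1 2 by linarith
    also have "\<dots> = L * \<Psi> \<tau>"
      by (simp add: L_def algebra_simps)
    finally show ?thesis .
  qed
  have "\<Psi> t * exp (- L * t) \<le> \<Psi> 0 * exp (- L * 0)"
  proof (rule DERIV_nonpos_imp_decreasing_open[of 0 t "\<lambda>\<tau>. \<Psi> \<tau> * exp (- L * \<tau>)"])
    show "0 \<le> t"
      using t by simp
    have "continuous_on {0..b} \<Psi>"
      by (rule DERIV_continuous_on) (rule \<Psi>_deriv)
    then have "continuous_on {0..t} \<Psi>"
      by (rule continuous_on_subset) (use t in auto)
    then show "continuous_on {0..t} (\<lambda>\<tau>. \<Psi> \<tau> * exp (- L * \<tau>))"
      by (intro continuous_intros)
    fix \<tau> assume "0 < \<tau>" "\<tau> < t"
    then have \<tau>: "\<tau> \<in> {0..b}" and "at \<tau> within {0..b} = at \<tau>"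
      using t by (auto simp: at_within_Icc_at)
    then have "(\<Psi> has_real_derivative \<Psi>' \<tau>) (at \<tau>)"
      using \<Psi>_deriv[OF \<tau>] by simp
    moreover have "((\<lambda>\<tau>. exp (- L * \<tau>)) has_real_derivative exp (- L * \<tau>) * - L) (at \<tau>)"
      by (auto intro!: derivative_eq_intros)
    ultimately have "((\<lambda>\<tau>. \<Psi> \<tau> * exp (- L * \<tau>)) has_real_derivative (\<Psi>' \<tau> - L * \<Psi> \<tau>) * exp (- L * \<tau>)) (at \<tau>)"
      by (rule DERIV_cong[OF DERIV_mult]) (simp add: algebra_simps)
    moreover have "(\<Psi>' \<tau> - L * \<Psi> \<tau>) * exp (- L * \<tau>) \<le> 0"
      using \<Psi>'_le[OF \<tau>] by (intro mult_nonpos_nonneg) auto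
    ultimately show "\<exists>y. ((\<lambda>\<tau>. \<Psi> \<tau> * exp (- L * \<tau>)) has_real_derivative y) (at \<tau>) \<and> y \<le> 0"
      by blast
  qed
  also have "\<Psi> 0 = 0"
    by (simp add: \<Psi>_def init)
  finally have "\<Psi> t * exp (- L * t) \<le> 0"
    by simp
  then have "\<Psi> t \<le> 0"
    by (meson exp_gt_zero mult_pos_pos not_le)
  have nonneg: "0 \<le> (l t e - l' t e)\<^sup>2 / l t e" if "e \<in> edge_set T" for e
    using pos(1)[OF t that] by simp
  then have "0 \<le> \<Psi> t"
    unfolding \<Psi>_def by (rule sum_nonneg)
  with \<open>\<Psi> t \<le> 0\<close> have "(\<Sum>e\<in>edge_set T. (l t e - l' t e)\<^sup>2 / l t e) = 0"
    unfolding \<Psi>_def by (rule order.antisym)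
  moreover have "(\<Sum>e\<in>edge_set T. (l t e - l' t e)\<^sup>2 / l t e) = 0 \<longleftrightarrow>
      (\<forall>e\<in>edge_set T. (l t e - l' t e)\<^sup>2 / l t e = 0)"
    by (rule sum_nonneg_eq_0_iff[OF finite]) (rule nonneg)
  ultimately have "(l t e - l' t e)\<^sup>2 / l t e = 0"
    using e by simp
  then show ?thesis
    using pos(1)[OF t e] by simp
qed

text \<open>The vector space has a coordinate for every set of tetrahedron edges, not only for the
  gluing classes. The extra coordinates do no harm, since the curvature depends only on values at
  \<open>edge_set T\<close>. Exponentiating makes positivity automatic.\<close>

lemma ext_Ricci_flow_exists_on:
  fixes T :: "'j::finite face_gluing"
  assumes pos: "\<And>e. e \<in> edge_set T \<Longrightarrow> 0 < l\<^sub>0 e" and "b \<ge> 0"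
  obtains l where "\<And>e. e \<in> edge_set T \<Longrightarrow> l 0 e = l\<^sub>0 e"
    and "\<And>t e. 0 < l t e"
    and "\<And>t e. t \<in> {0..b} \<Longrightarrow> e \<in> edge_set T \<Longrightarrow>
      ((\<lambda>\<tau>. l \<tau> e) has_real_derivative ext_curvature T (l t) e * l t e) (at t within {0..b})"
proof -
  define f :: "real ^ (('j \<times> 4 set) set) \<Rightarrow> real ^ (('j \<times> 4 set) set)"
    where "f u = (\<chi> e. ext_curvature T (\<lambda>e. exp (u $ e)) e)" for u
  have "continuous_on UNIV f"
    unfolding f_def by (intro continuous_on_vec_lambda continuous_on_ext_curvature continuous_intros)
  moreover have "norm (f u) \<le> (\<Sum>e\<in>(UNIV :: ('j \<times> 4 set) set set). 2 * pi + pi * card (tet_edges :: ('j \<times> 4 set) set))" for u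
    by (rule order.trans[OF norm_le_l1_cart], unfold f_def vec_lambda_beta, intro sum_mono ext_curvature_bound)
  ultimately obtain u where u0: "u 0 = (\<chi> e. ln (l\<^sub>0 e))"
    and u: "\<And>t. t \<in> {0..b} \<Longrightarrow> (u has_vector_derivative f (u t)) (at t within {0..b})"
    using Peano_existence[of f _ b "\<chi> e. ln (l\<^sub>0 e)"] \<open>b \<ge> 0\<close> by metis
  show thesis
  proof (rule that[of "\<lambda>t e. exp (u t $ e)"])
    show "exp (u 0 $ e) = l\<^sub>0 e" if "e \<in> edge_set T" for e
      using pos[OF that] by (simp add: u0)
    fix t e assume t: "t \<in> {0..b}"
    have "((\<lambda>\<tau>. u \<tau> $ e) has_vector_derivative f (u t) $ e) (at t within {0..b})"
      by (rule bounded_linear.has_vector_derivative[OF bounded_linear_vec_nth u[OF t]])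
    then have "((\<lambda>\<tau>. u \<tau> $ e) has_real_derivative ext_curvature T (\<lambda>e. exp (u t $ e)) e) (at t within {0..b})"
      by (simp add: has_real_derivative_iff_has_vector_derivative f_def)
    then show "((\<lambda>\<tau>. exp (u \<tau> $ e)) has_real_derivative
        ext_curvature T (\<lambda>e. exp (u t $ e)) e * exp (u t $ e)) (at t within {0..b})"
      by (auto intro!: derivative_eq_intros)
  qed simp
qed

theorem theorem1p5:
  fixes T :: "'j::finite face_gluing"
    and l\<^sub>0 :: "('j \<times> 4 set) set \<Rightarrow> real"
  assumes "closed_pseudo_3_manifold T"
    and "l\<^sub>0 \<in> hyperideal_metrics T"
  shows "\<exists>!l. l \<in> {0..} \<rightarrow>\<^sub>E hyperideal_metrics T \<and>
    (\<forall>e\<in>edge_set T. \<forall>t\<ge>0.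
       ((\<lambda>\<tau>. l \<tau> e) has_real_derivative ext_curvature T (l t) e * l t e) (at t within {0..})) \<and>
    l 0 = l\<^sub>0"
proof (rule ex_ex1I)
  have l0: "0 < l\<^sub>0 e" if "e \<in> edge_set T" for e
    using assms(2) that by (auto simp: hyperideal_metrics_def)
  have "\<exists>l. (\<forall>e\<in>edge_set T. l 0 e = l\<^sub>0 e) \<and> (\<forall>t e. 0 < l t e) \<and>
    (\<forall>t\<in>{0..real n}. \<forall>e\<in>edge_set T.
      ((\<lambda>\<tau>. l \<tau> e) has_real_derivative ext_curvature T (l t) e * l t e) (at t within {0..real n}))" for n
    using ext_Ricci_flow_exists_on[of T l\<^sub>0 "real n", OF l0] of_nat_0_le_iff[of n] by metis
  then obtain U where init: "\<And>n e. e \<in> edge_set T \<Longrightarrow> U n 0 e = l\<^sub>0 e"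
    and pos: "\<And>n t e. 0 < U n t e"
    and flow: "\<And>n t e. t \<in> {0..real n} \<Longrightarrow> e \<in> edge_set T \<Longrightarrow>
      ((\<lambda>\<tau>. U n \<tau> e) has_real_derivative ext_curvature T (U n t) e * U n t e) (at t within {0..real n})"
    by metis
  \<comment> \<open>Peano's theorem chooses the solution for each \<open>n\<close> separately, so
    uniqueness is what makes them fit together.\<close>
  have agree: "U m t e = U n t e" if "m \<le> n" "t \<in> {0..real m}" "e \<in> edge_set T" for m n t e
  proof (rule ext_Ricci_flow_unique_on[OF _ _ flow _ _ that(2,3)])
    fix \<tau> e' assume "\<tau> \<in> {0..real m}" "e' \<in> edge_set T"
    then show "((\<lambda>\<tau>. U n \<tau> e') has_real_derivative ext_curvature T (U n \<tau>) e' * U n \<tau> e') (at \<tau> within {0..real m})"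
      using that(1) by (intro DERIV_subset[OF flow[of \<tau> n e']]) auto
  qed (auto simp: init pos)
  define N where "N t = nat \<lceil>t\<rceil>" for t :: real
  have N: "t \<le> real (N t)" for t
    unfolding N_def by (rule real_nat_ceiling_ge)
  \<comment> \<open>Both restrictions fix the value \<open>undefined\<close> off the domains, as the
    extensional function spaces in the claim require.\<close>
  define l where "l = (\<lambda>t\<in>{0..}. \<lambda>e\<in>edge_set T. U (N t) t e)"
  have l_eq: "l t e = U n t e" if "t \<in> {0..real n}" "e \<in> edge_set T" for t n e
  proof -
    have "N t \<le> n"
      using that(1) by (simp add: N_def nat_le_iff ceiling_le_iff)
    then show ?thesis
      using agree[of "N t" n t e] that N[of t] by (simp add: l_def)
  qed
  have l_mem: "l \<in> {0..} \<rightarrow>\<^sub>E hyperideal_metrics T"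
    by (auto simp: l_def hyperideal_metrics_def pos)
  have l_flow: "((\<lambda>\<tau>. l \<tau> e) has_real_derivative ext_curvature T (l t) e * l t e) (at t within {0..})"
    if e: "e \<in> edge_set T" and t: "t \<ge> 0" for e t
  proof -
    \<comment> \<open>The successor keeps \<open>t\<close> strictly below the right end, so that
      near \<open>t\<close> the interval \<open>{0..real n}\<close> coincides with
      \<open>{0..}\<close>, also when \<open>t\<close> is an integer.\<close>
    define n where "n = Suc (N t)"
    have n: "t \<in> {0..real n}" "t < real n"
      using N[of t] t by (simp_all add: n_def)
    have "ext_curvature T (l t) e = ext_curvature T (U n t) e"
      by (rule ext_curvature_cong) (rule l_eq[OF n(1)])
    with flow[OF n(1) e] have "((\<lambda>\<tau>. U n \<tau> e) has_real_derivative ext_curvature T (l t) e * l t e) (at t within {0..real n})"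
      by (simp only: l_eq[OF n(1) e])
    then have "((\<lambda>\<tau>. l \<tau> e) has_real_derivative ext_curvature T (l t) e * l t e) (at t within {0..real n})"
      by (rule has_field_derivative_transform_within[OF _ zero_less_one n(1)]) (rule l_eq[OF _ e, symmetric])
    moreover have "at t within {0..real n} = at t within {0..}"
      by (rule at_within_nhd[of _ "{..<real n}"]) (use n in auto)
    ultimately show ?thesis
      by (simp only:)
  qed
  have l_0: "l 0 = l\<^sub>0"
  proof (rule ext)
    fix e
    show "l 0 e = l\<^sub>0 e"
    proof (cases "e \<in> edge_set T")
      case True
      then show ?thesis
        using l_eq[of 0 0 e] init[of e 0] by simp
    next
      case False
      then have "l\<^sub>0 e = undefined"
        by (rule PiE_arb[OF assms(2)[unfolded hyperideal_metrics_def]])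
      with False show ?thesis
        unfolding l_def by simp
    qed
  qed
  show "\<exists>l. l \<in> {0..} \<rightarrow>\<^sub>E hyperideal_metrics T \<and>
    (\<forall>e\<in>edge_set T. \<forall>t\<ge>0.
       ((\<lambda>\<tau>. l \<tau> e) has_real_derivative ext_curvature T (l t) e * l t e) (at t within {0..})) \<and>
    l 0 = l\<^sub>0"
    by (intro exI[of _ l] conjI ballI allI impI l_mem l_flow l_0)
next
  fix l l'
  assume l: "l \<in> {0..} \<rightarrow>\<^sub>E hyperideal_metrics T \<and>
    (\<forall>e\<in>edge_set T. \<forall>t\<ge>0.
       ((\<lambda>\<tau>. l \<tau> e) has_real_derivative ext_curvature T (l t) e * l t e) (at t within {0..})) \<and>
    l 0 = l\<^sub>0"
    and l': "l' \<in> {0..} \<rightarrow>\<^sub>E hyperideal_metrics T \<and>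
    (\<forall>e\<in>edge_set T. \<forall>t\<ge>0.
       ((\<lambda>\<tau>. l' \<tau> e) has_real_derivative ext_curvature T (l' t) e * l' t e) (at t within {0..})) \<and>
    l' 0 = l\<^sub>0"
  have mem: "l \<in> {0..} \<rightarrow>\<^sub>E hyperideal_metrics T" "l' \<in> {0..} \<rightarrow>\<^sub>E hyperideal_metrics T"
    using l l' by blast+
  have metric: "m t \<in> edge_set T \<rightarrow>\<^sub>E {0<..}" if "m \<in> {0..} \<rightarrow>\<^sub>E hyperideal_metrics T" "t \<in> {0..}"
    for m :: "real \<Rightarrow> ('j \<times> 4 set) set \<Rightarrow> real" and t
    using PiE_mem[OF that] by (simp only: hyperideal_metrics_def)
  have pos: "0 < m t e" if "m \<in> {0..} \<rightarrow>\<^sub>E hyperideal_metrics T" "t \<in> {0..}" "e \<in> edge_set T"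
    for m :: "real \<Rightarrow> ('j \<times> 4 set) set \<Rightarrow> real" and t e
    using PiE_mem[OF metric[OF that(1,2)] that(3)] by simp
  have flow: "((\<lambda>\<tau>. l \<tau> e) has_real_derivative ext_curvature T (l \<tau>) e * l \<tau> e) (at \<tau> within {0..t})"
      "((\<lambda>\<tau>. l' \<tau> e) has_real_derivative ext_curvature T (l' \<tau>) e * l' \<tau> e) (at \<tau> within {0..t})"
    if "\<tau> \<in> {0..t}" "e \<in> edge_set T" for \<tau> t e
    by (rule DERIV_subset[of _ _ _ "{0..}"]; use l l' that in simp)+
  have nonneg: "\<tau> \<in> {0..}" if "\<tau> \<in> {0..t}" for \<tau> t :: real
    using that by simp
  show "l = l'"
  proof (rule PiE_ext[OF mem])
    fix t :: real assume t: "t \<in> {0..}"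
    show "l t = l' t"
    proof (rule PiE_ext[OF metric[OF mem(1) t] metric[OF mem(2) t]])
      fix e assume e: "e \<in> edge_set T"
      show "l t e = l' t e"
      proof (rule ext_Ricci_flow_unique_on[where b = t and T = T and l = l and l' = l'])
        show "0 < l \<tau> e" "0 < l' \<tau> e" if "\<tau> \<in> {0..t}" "e \<in> edge_set T" for \<tau> e
          by (rule pos mem nonneg that)+
        show "l 0 e = l' 0 e" for e
          using l l' by simp
      qed (use flow e t in simp_all)
    qed
  qed
qed

end
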